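(* Consider any of the three picking systems Pcart-N, Pcart, Robot. Let $O_1,O_2,\ldots$ be i.i.d. random orders, let $Y\ge 0$ be a random variable with an arbitrary distribution and mean $\mu_Y<\infty$, let $Y_1,Y_2,\ldots$ be i.i.d. copies of $Y$, and let the sequence of orders and the sequence of arrival times be independent. In the case of Robot assume in addition that $\mathbb{E}[K_1]>1$, where $K_1$ is the number of picking locations of $O_1$. For $n\in\mathbb{N}$ let $I(n)^{rand}$ be the random instance with orders $(O_1,\ldots,O_n)$ and arrival times $R_j=Y_{(j)}$, $j=1,\ldots,n$, where $Y_{(1)}\le\ldots\le Y_{(n)}$ are the order statistics of $Y_1,\ldots,Y_n$. Then $$\lim_{n\to\infty}\frac{Reopt(I(n)^{rand})}{CIOPT(I(n)^{rand})}=1\quad\text{almost surely.}$$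
   Context: Warehouse. A warehouse is a rectilinear grid of length $L$ and width $W$ consisting of $a\ge 1$ equidistant parallel (vertical) aisles, each a segment of length $W$, and $b\ge 2$ equidistant (horizontal) cross-aisles, each a segment of length $L$; the outermost aisles and cross-aisles form the border of the grid (for $a=1$, $L=0$). The picker moves along aisles and cross-aisles at unit speed (and may wait); $d$ is the resulting shortest-path metric. The depot $l_d$ is a fixed point of the grid. Picking locations are points in aisles. The infrastructure ($W,L,a,b,l_d$ and the batching capacity $c\in\mathbb{N}$) is fixed. Instance. An instance $I$ consists of the infrastructure, a sequence of orders $o_1,\ldots,o_n$, where $o_j=\{s_j^1,\ldots,s_j^{k(j)}\}$ is a set of $k(j)\ge1$ picking locations (items), and arrival times $0\le r_1\le\ldots\le r_n$. The picker starts at $l_d$ at time 0. A solution partitions the orders into batches of at most $c$ orders, sequences the batches, and fixes for each batch a visiting sequence of all picking locations of its orders. Batches are processed one after another; an item of $o_j$ cannot be picked before $r_j$; picking itself takes zero time; an order cannot be split between batches. With a pushcart, every batch starts at the depot and ends with the picker's return to the depot, and the objective (total completion time) is the time of the final return to the depot. With a robot, the picker starts the next batch from the location where she picked the last item of the previous batch (a new empty robot is immediately available there), and the objective is the time at which the last item is picked. $CIOPT(I)$ is the minimum objective value when the whole instance is known in advance (the picker may then move towards locations of orders that have not arrived yet). Online policy Reopt and the three systems. Online, the number of orders is unknown and each order (with its picking locations) becomes known only at its arrival time. Reopt never anticipates future orders; when it reoptimizes at time $t$, it computes a plan with minimal total completion time for the orders that have arrived by $t$ and have not been completely picked, treating them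 as immediately available, and follows this plan until the next reoptimization; if there is nothing left to do, the picker stays where she is (at the depot initially and in the pushcart systems). - Pcart-N (pushcart, non-interventionist Reopt): reoptimization takes place only when the picker is at the depot (on each return to the depot if new orders have arrived, or on arrival of an order while she is idle at the depot); started batches cannot be modified. - Pcart (pushcart, interventionist Reopt) and Robot (robot, interventionist Reopt): reoptimization takes place at every order arrival; the plan starts from the picker's current position, orders having at least one item already in the current cart must be completed as part of the current batch, and all other bins of the current cart (of $c$ bins, one order per bin) can be freely (re)assigned to not yet commenced orders. Ties between optimal plans are broken by an arbitrary fixed deterministic rule. $Reopt(I)$ is the resulting total completion time (pushcart or robot objective according to the system), and $CIOPT(I)$ is taken for the same cart type. Stochastic conventions. A random order is $O_j=(K_j,S_j^1,\ldots,S_j^{K_j})$ with $K_j$ the number of its (distinct) picking locations $S_j^1,\ldots,S_j^{K_j}$; locations within the same order may be arbitrarily dependent. Distinct orders are i.i.d. $Reopt(\cdot)$ and $CIOPT(\cdot)$ are regarded as measurable functions of the random instance. Convention: a ratio $0/0$ equals 1. *)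

theory Defs
  imports "HOL-Probability.Probability"
begin

section \<open>Warehouse\<close>

type_synonym loc = "real \<times> real"

record warehouse =
  wh_length :: real
  wh_width :: real
  aisles :: nat
  cross_aisles :: nat
  depot :: loc
  capacity :: nat

text \<open>For a single aisle (length 0) the aisle abscissa below reads \<open>0 * 0 / 0 = 0\<close>.\<close>

definition in_aisle :: "warehouse \<Rightarrow> loc set" where
  "in_aisle w = {(x, y). \<exists>i < aisles w. x = real i * wh_length w / real (aisles w - 1)
                         \<and> 0 \<le> y \<and> y \<le> wh_width w}"

definition in_cross_aisle :: "warehouse \<Rightarrow> loc set" where
  "in_cross_aisle w = {(x, y). \<exists>j < cross_aisles w. y = real j * wh_width w / real (cross_aisles w - 1)
                               \<and> 0 \<le> x \<and> x \<le> wh_length w}"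

definition grid :: "warehouse \<Rightarrow> loc set" where
  "grid w = in_aisle w \<union> in_cross_aisle w"

definition is_warehouse :: "warehouse \<Rightarrow> bool" where
  "is_warehouse w \<longleftrightarrow> aisles w \<ge> 1 \<and> cross_aisles w \<ge> 2 \<and> wh_width w > 0
     \<and> (if aisles w = 1 then wh_length w = 0 else wh_length w > 0)
     \<and> depot w \<in> grid w \<and> capacity w \<ge> 1"

text \<open>A movement of the picker at unit speed, possibly with waiting, is a 1-Lipschitz curve that
  stays in the grid. The shortest-path metric is the least travel time.\<close>

definition wdist :: "warehouse \<Rightarrow> loc \<Rightarrow> loc \<Rightarrow> real" where
  "wdist w p q = Inf {T. 0 \<le> T \<and> (\<exists>\<gamma>. 1-lipschitz_on {0..T} \<gamma> \<and> \<gamma> ` {0..T} \<subseteq> grid w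
                                     \<and> \<gamma> 0 = p \<and> \<gamma> T = q)}"


section \<open>Orders, instances and batches\<close>

text \<open>An order is an enumeration, without repetition, of its set of picking locations.\<close>

type_synonym order_list = "loc list"

definition is_order :: "warehouse \<Rightarrow> order_list \<Rightarrow> bool" where
  "is_order w xs \<longleftrightarrow> xs \<noteq> [] \<and> distinct xs \<and> set xs \<subseteq> in_aisle w"

text \<open>An instance lists the arrival times with their orders, by nondecreasing arrival time.
  The item \<open>(j, s)\<close> is the picking location \<open>s\<close> of order number \<open>j\<close> (counted from 0); the same
  location may occur in several orders.\<close>

type_synonym inst = "(real \<times> order_list) list"
type_synonym item = "nat \<times> loc"

definition items :: "inst \<Rightarrow> item set" where
  "items I = {(j, s). j < length I \<and> s \<in> set (snd (I ! j))}"

text \<open>A batch is given by the visiting sequence of its items.\<close>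

type_synonym batch = "item list"

definition batch_orders :: "batch \<Rightarrow> nat set" where
  "batch_orders B = fst ` set B"

text \<open>Admissibility of the sets of orders that are assigned to the successive carts: at most
  \<open>capacity w\<close> orders in each, and no order is split between two of them.\<close>

definition cart_loads :: "warehouse \<Rightarrow> nat set list \<Rightarrow> bool" where
  "cart_loads w Xs \<longleftrightarrow> (\<forall>X \<in> set Xs. finite X \<and> card X \<le> capacity w)
                       \<and> sorted_wrt (\<lambda>X Y. X \<inter> Y = {}) Xs"


section \<open>Picking systems and evaluation of visiting sequences\<close>

datatype system = PcartN | Pcart | Robot

text \<open>\<open>Finish\<close> is the end of a batch: the return to the depot with a pushcart, and the change to
  an empty robot on the spot with robots.\<close>

datatype stop = Pick nat loc | Finish

definition stops :: "batch list \<Rightarrow> stop list" where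
  "stops Bs = concat (map (\<lambda>B. map (\<lambda>(j, s). Pick j s) B @ [Finish]) Bs)"

fun stop_loc :: "system \<Rightarrow> warehouse \<Rightarrow> loc \<Rightarrow> stop \<Rightarrow> loc" where
  "stop_loc sys w p (Pick j s) = s"
| "stop_loc sys w p Finish = (if sys = Robot then p else depot w)"

text \<open>Earliest completion time of a sequence of stops, starting at time \<open>t\<close> in \<open>p\<close>, if the items of
  order \<open>j\<close> cannot be picked before \<open>r j\<close>. The picker may travel to a location before that time and
  wait there.\<close>

fun completion :: "system \<Rightarrow> warehouse \<Rightarrow> (nat \<Rightarrow> real) \<Rightarrow> real \<Rightarrow> loc \<Rightarrow> stop list \<Rightarrow> real" where
  "completion sys w r t p [] = t"
| "completion sys w r t p (Pick j s # xs) = completion sys w r (max (t + wdist w p s) (r j)) s xs"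
| "completion sys w r t p (Finish # xs) =
     (let q = stop_loc sys w p Finish in completion sys w r (t + wdist w p q) q xs)"


section \<open>Offline optimum\<close>

definition solution :: "warehouse \<Rightarrow> inst \<Rightarrow> batch list \<Rightarrow> bool" where
  "solution w I Bs \<longleftrightarrow> [] \<notin> set Bs \<and> distinct (concat Bs) \<and> set (concat Bs) = items I
                       \<and> cart_loads w (map batch_orders Bs)"

definition ciopt :: "system \<Rightarrow> warehouse \<Rightarrow> inst \<Rightarrow> real" where
  "ciopt sys w I =
     (INF Bs \<in> {Bs. solution w I Bs}. completion sys w (\<lambda>j. fst (I ! j)) 0 (depot w) (stops Bs))"


section \<open>Plans of the online policy\<close>

text \<open>What is known when a plan is made: the orders that have arrived so far with their arrival
  times, the position of the picker, the orders with at least one item in the current cart (those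
  that are already complete still occupy a bin), and the items picked so far.\<close>

record situation =
  now :: real
  arrived :: inst
  position :: loc
  cart :: "nat set"
  picked :: "item set"

definition is_situation :: "warehouse \<Rightarrow> situation \<Rightarrow> bool" where
  "is_situation w S \<longleftrightarrow>
     sorted (map fst (arrived S)) \<and> (\<forall>(r, xs) \<in> set (arrived S). 0 \<le> r \<and> r \<le> now S \<and> is_order w xs)
     \<and> position S \<in> grid w
     \<and> picked S \<subseteq> items (arrived S)
     \<and> cart S \<subseteq> fst ` picked S \<and> card (cart S) \<le> capacity w
     \<and> (\<forall>(j, s) \<in> items (arrived S) - picked S. j \<in> fst ` picked S \<longrightarrow> j \<in> cart S)"

text \<open>A plan consists of the rest of the current batch (possibly empty), the later batches, and the
  position of the picker as a function of time. A pushcart batch whose items are all picked still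
  has to be brought back to the depot, so an empty rest of the current batch is meaningful.\<close>

record plan =
  current :: batch
  later :: "batch list"
  motion :: "real \<Rightarrow> loc"

definition plan_stops :: "plan \<Rightarrow> stop list" where
  "plan_stops \<pi> = stops (current \<pi> # later \<pi>)"

text \<open>Since the load of the current cart includes \<open>cart S\<close>, the commenced orders can only be completed
  in the current batch.\<close>

definition feasible_plan :: "warehouse \<Rightarrow> situation \<Rightarrow> plan \<Rightarrow> bool" where
  "feasible_plan w S \<pi> \<longleftrightarrow>
     [] \<notin> set (later \<pi>)
     \<and> distinct (concat (current \<pi> # later \<pi>))
     \<and> set (concat (current \<pi> # later \<pi>)) = items (arrived S) - picked S
     \<and> cart_loads w ((cart S \<union> batch_orders (current \<pi>)) # map batch_orders (later \<pi>))"

definition plan_completion :: "system \<Rightarrow> warehouse \<Rightarrow> situation \<Rightarrow> plan \<Rightarrow> real" where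
  "plan_completion sys w S \<pi> = completion sys w (\<lambda>_. now S) (now S) (position S) (plan_stops \<pi>)"

fun visits :: "system \<Rightarrow> warehouse \<Rightarrow> (real \<Rightarrow> loc) \<Rightarrow> real \<Rightarrow> loc \<Rightarrow> stop list \<Rightarrow> bool" where
  "visits sys w m t p [] \<longleftrightarrow> (\<forall>u \<ge> t. m u = p)"
| "visits sys w m t p (x # xs) \<longleftrightarrow>
     m t = p \<and> (let q = stop_loc sys w p x in visits sys w m (t + wdist w p q) q xs)"

definition optimal_plan :: "system \<Rightarrow> warehouse \<Rightarrow> situation \<Rightarrow> plan \<Rightarrow> bool" where
  "optimal_plan sys w S \<pi> \<longleftrightarrow>
     feasible_plan w S \<pi>
     \<and> (\<forall>\<pi>'. feasible_plan w S \<pi>' \<longrightarrow> plan_completion sys w S \<pi> \<le> plan_completion sys w S \<pi>')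
     \<and> 1-lipschitz_on {now S..} (motion \<pi>) \<and> motion \<pi> ` {now S..} \<subseteq> grid w
     \<and> visits sys w (motion \<pi>) (now S) (position S) (plan_stops \<pi>)"

text \<open>A deterministic rule that selects one of the optimal plans.\<close>

definition reopt_rule :: "system \<Rightarrow> warehouse \<Rightarrow> (situation \<Rightarrow> plan) \<Rightarrow> bool" where
  "reopt_rule sys w \<rho> \<longleftrightarrow> (\<forall>S. is_situation w S \<longrightarrow> optimal_plan sys w S (\<rho> S))"


section \<open>Reopt\<close>

definition arrived_by :: "inst \<Rightarrow> real \<Rightarrow> inst" where
  "arrived_by I t = takeWhile (\<lambda>(r, xs). r \<le> t) I"

text \<open>Load of the cart and picked items at time \<open>u\<close>, if the stops are visited from time \<open>t\<close> on,
  starting in \<open>p\<close>, without waiting.\<close>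

fun execute :: "system \<Rightarrow> warehouse \<Rightarrow> real \<Rightarrow> real \<Rightarrow> loc \<Rightarrow> stop list
                \<Rightarrow> nat set \<times> item set \<Rightarrow> nat set \<times> item set" where
  "execute sys w u t p [] CP = CP"
| "execute sys w u t p (x # xs) CP =
     (let q = stop_loc sys w p x; t' = t + wdist w p q in
      if t' \<le> u
      then execute sys w u t' q xs
             (case x of Pick j s \<Rightarrow> (insert j (fst CP), insert (j, s) (snd CP))
                      | Finish \<Rightarrow> ({}, snd CP))
      else CP)"

text \<open>Interventionist policy. The last argument lists the remaining times of reoptimization; the
  other ones describe the state at the first of these times.\<close>

fun interventionist :: "system \<Rightarrow> warehouse \<Rightarrow> (situation \<Rightarrow> plan) \<Rightarrow> inst
    \<Rightarrow> loc \<Rightarrow> nat set \<times> item set \<Rightarrow> real list \<Rightarrow> real" where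
  "interventionist sys w \<rho> I p CP [] = 0"
| "interventionist sys w \<rho> I p CP (t # ts) =
     (let S = \<lparr>now = t, arrived = arrived_by I t, position = p, cart = fst CP, picked = snd CP\<rparr>;
          \<pi> = \<rho> S
      in case ts of
           [] \<Rightarrow> plan_completion sys w S \<pi>
         | u # _ \<Rightarrow> interventionist sys w \<rho> I (motion \<pi> u) (execute sys w u t p (plan_stops \<pi>) CP) ts)"

text \<open>Non-interventionist policy. The picker is at the depot at time \<open>t\<close>; \<open>k\<close> is the number of orders
  that had arrived at the last reoptimization, \<open>Bs\<close> are the batches of the current plan that have
  not been started, and \<open>P\<close> are the items picked so far.\<close>

partial_function (tailrec) non_interventionist :: "warehouse \<Rightarrow> (situation \<Rightarrow> plan) \<Rightarrow> inst
    \<Rightarrow> real \<Rightarrow> nat \<Rightarrow> batch list \<Rightarrow> item set \<Rightarrow> real" where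
  "non_interventionist w \<rho> I t k Bs P =
     (if k < length (arrived_by I t)
      then (let \<pi> = \<rho> \<lparr>now = t, arrived = arrived_by I t, position = depot w, cart = {}, picked = P\<rparr>
            in non_interventionist w \<rho> I t (length (arrived_by I t))
                 (filter (\<lambda>B. B \<noteq> []) (current \<pi> # later \<pi>)) P)
      else case Bs of
             B # Bs' \<Rightarrow> non_interventionist w \<rho> I (completion PcartN w (\<lambda>_. t) t (depot w) (stops [B]))
                          k Bs' (P \<union> set B)
           | [] \<Rightarrow> if k < length I then non_interventionist w \<rho> I (fst (I ! k)) k [] P else t)"

definition reopt :: "system \<Rightarrow> warehouse \<Rightarrow> (situation \<Rightarrow> plan) \<Rightarrow> inst \<Rightarrow> real" where
  "reopt sys w \<rho> I =
     (if sys = PcartN then non_interventionist w \<rho> I 0 0 [] {}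
      else interventionist sys w \<rho> I (depot w) ({}, {}) (sorted_list_of_set (fst ` set I)))"


section \<open>Random instances\<close>

text \<open>The sigma-algebra on orders that is generated by the number of picking locations and the
  individual locations (padded beyond the end of the list).\<close>

definition order_space :: "order_list measure" where
  "order_space = vimage_algebra UNIV
     (\<lambda>xs. (length xs, \<lambda>i. if i < length xs then xs ! i else 0))
     (count_space UNIV \<Otimes>\<^sub>M (\<Pi>\<^sub>M i \<in> (UNIV :: nat set). (borel :: loc measure)))"

definition order_stat_inst :: "(nat \<Rightarrow> order_list) \<Rightarrow> (nat \<Rightarrow> real) \<Rightarrow> nat \<Rightarrow> inst" where
  "order_stat_inst ords ys n = zip (sort (map ys [0..<n])) (map ords [0..<n])"

definition ratio :: "real \<Rightarrow> real \<Rightarrow> real" where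
  "ratio x y = (if x = 0 \<and> y = 0 then 1 else x / y)"

end

theory Submission
  imports Defs "HOL-Library.Sublist"
begin

text \<open>
  The policy finishes soon after the last arrival time \<open>R\<^sub>n\<close>. Once all orders are known, it follows
  a plan that is not longer than completing the commenced orders, on one walk through the
  grid of bounded length, and then serving the untouched orders in the batches of an offline solution
  (lemmas \<open>completing_plan\<close> and \<open>optimal_plan_le\<close>). Without interventions, the batch that is under way at time
  \<open>R\<^sub>n\<close> is finished first, but by optimality it takes no longer than a walk through the grid
  (\<open>optimal_batch_le\<close>). With a constant \<open>K\<close> that depends only on the warehouse this gives
  \<open>CIOPT \<le> Reopt \<le> CIOPT + R\<^sub>n + K\<close> (\<open>reopt_bounds\<close>). The lower bound says that the actual course of the
  policy is itself a solution: whatever the picker has done so far is the beginning of a schedule,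
  and a schedule executed as early as possible is never behind the picker (\<open>completion_subseq\<close>,
  \<open>history\<close>).

  It remains to see that \<open>R\<^sub>n + K\<close> is small compared with \<open>CIOPT\<close>. The maximum \<open>R\<^sub>n\<close> of \<open>n\<close> copies of a variable with
  finite mean is almost surely \<open>o(n)\<close> by the Borel--Cantelli lemma (\<open>AE_eventually_le_linear\<close>).
  On the other hand \<open>CIOPT\<close> grows linearly, apart from a degenerate case: call an order wide if it
  contains a point far from the depot (with a pushcart) or two points far from each other (with robots). A batch with a wide order travels some
  fixed distance and holds only boundedly many orders (\<open>ciopt_ge_wide_orders\<close>), and if wide orders
  have positive probability, then a positive fraction of all orders is wide (\<open>AE_eventually_frequency\<close>).

  If no order is wide for any threshold, then with robots almost all orders consist of a single item,
  contrary to the assumption, and with a pushcart almost all items lie at the depot. In the latter case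
  nobody ever moves and both objectives equal \<open>R\<^sub>n\<close>, so that the ratio is 1, also when \<open>R\<^sub>n = 0\<close>.
\<close>

section \<open>The shortest-path metric of the grid\<close>

locale valid_warehouse =
  fixes w :: warehouse
  assumes valid: "is_warehouse w"
begin

lemma depot_in_grid: "depot w \<in> grid w"
  using valid by (simp add: is_warehouse_def)

lemma in_aisle_subset_grid: "in_aisle w \<subseteq> grid w"
  by (auto simp: grid_def)

lemma wh_length_nonneg: "0 \<le> wh_length w"
  using valid by (auto simp: is_warehouse_def split: if_splits)

lemma wh_width_nonneg: "0 \<le> wh_width w"
  using valid by (auto simp: is_warehouse_def)

text \<open>The travel times whose infimum is \<open>wdist\<close>; as a relation they can be composed.\<close>

definition reaches :: "loc \<Rightarrow> loc \<Rightarrow> real \<Rightarrow> bool" where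
  "reaches p q T \<longleftrightarrow> 0 \<le> T \<and> (\<exists>\<gamma>. 1-lipschitz_on {0..T} \<gamma> \<and> \<gamma> ` {0..T} \<subseteq> grid w \<and> \<gamma> 0 = p \<and> \<gamma> T = q)"

lemma wdist_eq_Inf: "wdist w p q = Inf {T. reaches p q T}"
  by (simp add: wdist_def reaches_def)

lemma bdd_below_reaches: "bdd_below {T. reaches p q T}"
  by (rule bdd_belowI[of _ 0]) (auto simp: reaches_def)

lemma wdist_le: "reaches p q T \<Longrightarrow> wdist w p q \<le> T"
  unfolding wdist_eq_Inf by (rule cInf_lower) (auto intro: bdd_below_reaches)

lemma dist_le_if_reaches: "reaches p q T \<Longrightarrow> dist p q \<le> T"
  unfolding reaches_def using lipschitz_onD[of 1 "{0..T}" _ 0 T] by fastforce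

lemma reaches_refl: "p \<in> grid w \<Longrightarrow> reaches p p 0"
  unfolding reaches_def
  by (auto intro!: exI[of _ "\<lambda>_. p"] lipschitz_on_mono[OF lipschitz_on_constant])

lemma reaches_trans:
  assumes "reaches p q S" "reaches q s T"
  shows "reaches p s (S + T)"
proof -
  obtain f g where f: "0 \<le> S" "1-lipschitz_on {0..S} f" "f ` {0..S} \<subseteq> grid w" "f 0 = p" "f S = q"
    and g: "0 \<le> T" "1-lipschitz_on {0..T} g" "g ` {0..T} \<subseteq> grid w" "g 0 = q" "g T = s"
    using assms unfolding reaches_def by blast
  have "1-lipschitz_on {S..S + T} (\<lambda>u. g (u - S))"
  proof (rule lipschitz_onI)
    fix x y assume "x \<in> {S..S + T}" "y \<in> {S..S + T}"
    then have "dist (g (x - S)) (g (y - S)) \<le> 1 * dist (x - S) (y - S)"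
      by (intro lipschitz_onD[OF g(2)]) auto
    then show "dist (g (x - S)) (g (y - S)) \<le> 1 * dist x y"
      by (simp add: dist_real_def)
  qed simp
  then have "1-lipschitz_on {0..S + T} (\<lambda>u. if u \<le> S then f u else g (u - S))"
    by (intro lipschitz_on_concat f) (simp_all add: f g)
  moreover have "(\<lambda>u. if u \<le> S then f u else g (u - S)) ` {0..S + T} \<subseteq> grid w"
  proof (intro image_subsetI)
    fix u assume "u \<in> {0..S + T}"
    then show "(if u \<le> S then f u else g (u - S)) \<in> grid w"
      using f(3) g(3) by (cases "u \<le> S") (auto simp: image_subset_iff)
  qed
  moreover have "(if S + T \<le> S then f (S + T) else g (S + T - S)) = s"
    using f g by (cases "T = 0") auto
  ultimately show ?thesis
    unfolding reaches_def using f(1,4) g(1)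
    by (intro conjI exI[of _ "\<lambda>u. if u \<le> S then f u else g (u - S)"]) auto
qed

lemma reaches_segment:
  assumes "closed_segment p q \<subseteq> grid w"
  shows "reaches p q (dist p q)"
proof (cases "p = q")
  case True
  then show ?thesis using assms by (auto intro: reaches_refl)
next
  case False
  define d where "d = dist p q"
  have d: "d > 0" using False by (simp add: d_def)
  define \<gamma> where "\<gamma> = (\<lambda>u. p + (u / d) *\<^sub>R (q - p))"
  have "1-lipschitz_on {0..d} \<gamma>"
  proof (rule lipschitz_onI)
    fix x y
    have "dist (\<gamma> x) (\<gamma> y) = \<bar>x / d - y / d\<bar> * norm (q - p)"
      by (simp add: \<gamma>_def dist_norm flip: scaleR_diff_left)
    also have "\<dots> = \<bar>x - y\<bar>"
      using d by (simp add: d_def dist_norm norm_minus_commute flip: diff_divide_distrib)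
    finally show "dist (\<gamma> x) (\<gamma> y) \<le> 1 * dist x y" by (simp add: dist_real_def)
  qed simp
  moreover have "\<gamma> ` {0..d} \<subseteq> grid w"
  proof (intro image_subsetI)
    fix u assume u: "u \<in> {0..d}"
    have "\<gamma> u = (1 - u / d) *\<^sub>R p + (u / d) *\<^sub>R q"
      by (simp add: \<gamma>_def algebra_simps)
    moreover have "0 \<le> u / d" "u / d \<le> 1" using u d by auto
    ultimately have "\<gamma> u \<in> closed_segment p q" by (auto simp: in_segment)
    then show "\<gamma> u \<in> grid w" using assms by blast
  qed
  moreover have "\<gamma> 0 = p" "\<gamma> d = q" using d by (auto simp: \<gamma>_def)
  ultimately show ?thesis using d unfolding reaches_def d_def by auto
qed

lemma segment_in_aisle:
  assumes "(x, y) \<in> in_aisle w" "(x, y') \<in> in_aisle w"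
  shows "closed_segment (x, y) (x, y') \<subseteq> grid w"
proof -
  have "closed_segment (x, y) (x, y') \<subseteq> {x} \<times> closed_segment y y'"
    by (auto simp: in_segment algebra_simps)
  moreover have "closed_segment y y' \<subseteq> {0..wh_width w}"
    using assms by (auto simp: in_aisle_def closed_segment_eq_real_ivl)
  ultimately show ?thesis
    using assms(1) by (fastforce simp: grid_def in_aisle_def)
qed

lemma segment_in_cross_aisle:
  assumes "(x, y) \<in> in_cross_aisle w" "(x', y) \<in> in_cross_aisle w"
  shows "closed_segment (x, y) (x', y) \<subseteq> grid w"
proof -
  have "closed_segment (x, y) (x', y) \<subseteq> closed_segment x x' \<times> {y}"
    by (auto simp: in_segment algebra_simps)
  moreover have "closed_segment x x' \<subseteq> {0..wh_length w}"
    using assms by (auto simp: in_cross_aisle_def closed_segment_eq_real_ivl)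
  ultimately show ?thesis
    using assms(1) by (fastforce simp: grid_def in_cross_aisle_def)
qed

lemma aisle_ends_in_cross_aisle:
  assumes "(x, y) \<in> in_aisle w"
  shows "(x, 0) \<in> in_aisle w" "(x, 0) \<in> in_cross_aisle w"
proof -
  obtain i where i: "i < aisles w" "x = real i * wh_length w / real (aisles w - 1)"
    using assms by (auto simp: in_aisle_def)
  have "real i * wh_length w / real (aisles w - 1) \<le> wh_length w"
  proof (cases "aisles w - 1 = 0")
    case False
    have "real i * wh_length w \<le> real (aisles w - 1) * wh_length w"
      using i wh_length_nonneg by (intro mult_right_mono) auto
    then show ?thesis using False by (simp add: divide_le_eq mult.commute)
  qed (simp add: wh_length_nonneg)
  moreover have "0 \<le> x" unfolding i using wh_length_nonneg by simp
  moreover have "0 < cross_aisles w" using valid by (auto simp: is_warehouse_def)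
  ultimately show "(x, 0) \<in> in_cross_aisle w"
    using i by (auto simp: in_cross_aisle_def intro!: exI[of _ 0])
  show "(x, 0) \<in> in_aisle w" using i wh_width_nonneg by (auto simp: in_aisle_def)
qed

lemma cross_aisle_ends_in_aisle:
  assumes "(x, y) \<in> in_cross_aisle w"
  shows "(0, y) \<in> in_cross_aisle w" "(0, y) \<in> in_aisle w"
proof -
  obtain j where j: "j < cross_aisles w" "y = real j * wh_width w / real (cross_aisles w - 1)"
    using assms by (auto simp: in_cross_aisle_def)
  have "real j * wh_width w \<le> real (cross_aisles w - 1) * wh_width w"
    using j wh_width_nonneg by (intro mult_right_mono) auto
  moreover have "cross_aisles w - 1 > 0" using valid by (auto simp: is_warehouse_def)
  ultimately have "y \<le> wh_width w" unfolding j by (simp add: divide_le_eq mult.commute)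
  moreover have "0 \<le> y" unfolding j using wh_width_nonneg by simp
  moreover have "0 < aisles w" using valid by (auto simp: is_warehouse_def)
  ultimately show "(0, y) \<in> in_aisle w"
    by (auto simp: in_aisle_def intro!: exI[of _ 0])
  show "(0, y) \<in> in_cross_aisle w" using j wh_length_nonneg by (auto simp: in_cross_aisle_def)
qed

lemma abs_le_if_in_grid:
  assumes "(x, y) \<in> grid w"
  shows "\<bar>x\<bar> \<le> wh_length w" "\<bar>y\<bar> \<le> wh_width w"
proof -
  have "(x, 0) \<in> in_cross_aisle w \<or> (x, y) \<in> in_cross_aisle w"
    and "(0, y) \<in> in_aisle w \<or> (x, y) \<in> in_aisle w"
    using assms aisle_ends_in_cross_aisle[of x y] cross_aisle_ends_in_aisle[of x y]
    by (auto simp: grid_def)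
  then show "\<bar>x\<bar> \<le> wh_length w" "\<bar>y\<bar> \<le> wh_width w"
    by (auto simp: in_cross_aisle_def in_aisle_def)
qed

text \<open>The corner \<open>(0, 0)\<close> serves as a hub: from a point of an aisle it is reached along that aisle and
  the lowest cross-aisle, from a point of a cross-aisle along that cross-aisle and the leftmost aisle.
  So the grid is connected, which makes \<open>wdist\<close> the infimum of a nonempty set.\<close>

lemma reaches_via_origin:
  assumes "p \<in> grid w"
  shows "\<exists>T \<le> wh_length w + wh_width w. reaches p (0, 0) T"
    and "\<exists>T \<le> wh_length w + wh_width w. reaches (0, 0) p T"
proof -
  obtain x y where p: "p = (x, y)" by (cases p)
  obtain s where s: "closed_segment p s \<subseteq> grid w" "closed_segment s (0, 0) \<subseteq> grid w"
    and len: "dist p s + dist s (0, 0) \<le> wh_length w + wh_width w"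
  proof (cases "p \<in> in_aisle w")
    case True
    then show ?thesis
      using that[of "(x, 0)"] aisle_ends_in_cross_aisle[of x y] abs_le_if_in_grid[of x y] assms
        segment_in_aisle[of x y 0] segment_in_cross_aisle[of x 0 0] cross_aisle_ends_in_aisle[of x 0]
      by (auto simp: p dist_Pair_Pair)
  next
    case False
    then have "(x, y) \<in> in_cross_aisle w" using assms by (auto simp: p grid_def)
    then show ?thesis
      using that[of "(0, y)"] cross_aisle_ends_in_aisle[of x y] abs_le_if_in_grid[of x y] assms
        segment_in_cross_aisle[of x y 0] segment_in_aisle[of 0 y 0] aisle_ends_in_cross_aisle[of 0 y]
      by (auto simp: p dist_Pair_Pair)
  qed
  show "\<exists>T \<le> wh_length w + wh_width w. reaches p (0, 0) T"
    using reaches_trans[OF reaches_segment[OF s(1)] reaches_segment[OF s(2)]] len by blast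
  have "closed_segment (0, 0) s \<subseteq> grid w" "closed_segment s p \<subseteq> grid w"
    using s by (simp_all add: closed_segment_commute)
  then have "reaches (0, 0) p (dist (0, 0) s + dist s p)"
    by (intro reaches_trans[of _ s] reaches_segment)
  then show "\<exists>T \<le> wh_length w + wh_width w. reaches (0, 0) p T"
    using len by (intro exI[of _ "dist (0, 0) s + dist s p"]) (simp add: dist_commute)
qed

text \<open>A bound on the length of a way via the hub.\<close>

definition diameter_bound :: real where
  "diameter_bound = 2 * (wh_length w + wh_width w)"

lemma diameter_bound_nonneg: "0 \<le> diameter_bound"
  by (simp add: diameter_bound_def wh_length_nonneg wh_width_nonneg)

lemma reaches_within_diameter:
  assumes "p \<in> grid w" "q \<in> grid w"
  shows "\<exists>T \<le> diameter_bound. reaches p q T"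
proof -
  obtain S T where "reaches p (0, 0) S" "S \<le> wh_length w + wh_width w"
    "reaches (0, 0) q T" "T \<le> wh_length w + wh_width w"
    using reaches_via_origin(1)[OF assms(1)] reaches_via_origin(2)[OF assms(2)] by blast
  then show ?thesis
    by (intro exI[of _ "S + T"]) (auto simp: diameter_bound_def intro: reaches_trans)
qed

lemma wdist_le_diameter:
  "p \<in> grid w \<Longrightarrow> q \<in> grid w \<Longrightarrow> wdist w p q \<le> diameter_bound"
  using reaches_within_diameter wdist_le order_trans by blast

lemma dist_le_wdist: "p \<in> grid w \<Longrightarrow> q \<in> grid w \<Longrightarrow> dist p q \<le> wdist w p q"
  unfolding wdist_eq_Inf using reaches_within_diameter[of p q]
  by (intro cInf_greatest) (auto intro: dist_le_if_reaches)

lemma wdist_nonneg: "p \<in> grid w \<Longrightarrow> q \<in> grid w \<Longrightarrow> 0 \<le> wdist w p q"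
  using dist_le_wdist zero_le_dist order_trans by blast

lemma wdist_self [simp]: "p \<in> grid w \<Longrightarrow> wdist w p p = 0"
  using wdist_le[OF reaches_refl, of p] wdist_nonneg[of p p] by simp

lemma wdist_triangle:
  assumes "p \<in> grid w" "q \<in> grid w" "s \<in> grid w"
  shows "wdist w p s \<le> wdist w p q + wdist w q s"
proof (rule field_le_epsilon)
  fix e :: real assume "0 < e"
  obtain S where S: "reaches p q S" "S < wdist w p q + e / 2"
    using cInf_lessD[of "{T. reaches p q T}" "wdist w p q + e / 2"] \<open>0 < e\<close>
      reaches_within_diameter[OF assms(1,2)] by (auto simp: wdist_eq_Inf)
  obtain T where T: "reaches q s T" "T < wdist w q s + e / 2"
    using cInf_lessD[of "{T. reaches q s T}" "wdist w q s + e / 2"] \<open>0 < e\<close>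
      reaches_within_diameter[OF assms(2,3)] by (auto simp: wdist_eq_Inf)
  show "wdist w p s \<le> wdist w p q + wdist w q s + e"
    using wdist_le[OF reaches_trans[OF S(1) T(1)]] S(2) T(2) by simp
qed

lemma wdist_in_aisle:
  assumes "(x, y) \<in> in_aisle w" "(x, y') \<in> in_aisle w"
  shows "wdist w (x, y) (x, y') \<le> \<bar>y - y'\<bar>"
  using wdist_le[OF reaches_segment[OF segment_in_aisle[OF assms]]]
  by (simp add: dist_Pair_Pair dist_real_def)

lemma wdist_along_motion:
  assumes "1-lipschitz_on {t..} m" "m ` {t..} \<subseteq> grid w" "t \<le> s" "s \<le> u"
  shows "wdist w (m s) (m u) \<le> u - s"
proof (rule wdist_le)
  have "1-lipschitz_on {0..u - s} (\<lambda>v. m (s + v))"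
  proof (rule lipschitz_onI)
    fix x y assume "x \<in> {0..u - s}" "y \<in> {0..u - s}"
    then show "dist (m (s + x)) (m (s + y)) \<le> 1 * dist x y"
      using lipschitz_onD[OF assms(1), of "s + x" "s + y"] assms by (simp add: dist_real_def)
  qed simp
  then show "reaches (m s) (m u) (u - s)"
    using assms unfolding reaches_def by (auto intro!: exI[of _ "\<lambda>v. m (s + v)"])
qed

end

section \<open>Travel times of stop sequences\<close>

definition end_loc :: "system \<Rightarrow> warehouse \<Rightarrow> loc \<Rightarrow> stop list \<Rightarrow> loc" where
  "end_loc sys w p xs = foldl (stop_loc sys w) p xs"

text \<open>Travel time alone. It is the time that a plan takes, since all orders of a plan have arrived.\<close>

fun tour :: "system \<Rightarrow> warehouse \<Rightarrow> loc \<Rightarrow> stop list \<Rightarrow> real" where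
  "tour sys w p [] = 0"
| "tour sys w p (x # xs) = wdist w p (stop_loc sys w p x) + tour sys w (stop_loc sys w p x) xs"

text \<open>Earliest departure from a stop that is reached at time \<open>t\<close>.\<close>

fun release :: "(nat \<Rightarrow> real) \<Rightarrow> stop \<Rightarrow> real \<Rightarrow> real" where
  "release r (Pick j s) t = max t (r j)"
| "release r Finish t = t"

abbreviation picks :: "item list \<Rightarrow> stop list" where
  "picks B \<equiv> map (\<lambda>(j, s). Pick j s) B"

lemma end_loc_simps [simp]:
  "end_loc sys w p [] = p"
  "end_loc sys w p (x # xs) = end_loc sys w (stop_loc sys w p x) xs"
  "end_loc sys w p (xs @ ys) = end_loc sys w (end_loc sys w p xs) ys"
  by (simp_all add: end_loc_def)

lemma tour_append [simp]:
  "tour sys w p (xs @ ys) = tour sys w p xs + tour sys w (end_loc sys w p xs) ys"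
  by (induction xs arbitrary: p) simp_all

lemma completion_Cons:
  "completion sys w r t p (x # xs) =
     completion sys w r (release r x (t + wdist w p (stop_loc sys w p x))) (stop_loc sys w p x) xs"
  by (cases x) (simp_all add: Let_def)

lemma completion_append [simp]:
  "completion sys w r t p (xs @ ys) =
     completion sys w r (completion sys w r t p xs) (end_loc sys w p xs) ys"
  by (induction xs arbitrary: t p) (simp_all add: completion_Cons del: completion.simps(2,3))

lemma stops_simps [simp]:
  "stops [] = []"
  "stops (B # Bs) = picks B @ Finish # stops Bs"
  "stops (Bs @ Cs) = stops Bs @ stops Cs"
  by (simp_all add: stops_def)

lemma Pick_in_stops: "Pick j s \<in> set (stops Bs) \<longleftrightarrow> (j, s) \<in> set (concat Bs)"
  by (induction Bs) force+

definition stops_within :: "loc set \<Rightarrow> stop list \<Rightarrow> bool" where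
  "stops_within A xs \<longleftrightarrow> (\<forall>j s. Pick j s \<in> set xs \<longrightarrow> s \<in> A)"

lemma stops_within_simps [simp]:
  "stops_within A []"
  "stops_within A (Pick j s # xs) \<longleftrightarrow> s \<in> A \<and> stops_within A xs"
  "stops_within A (Finish # xs) \<longleftrightarrow> stops_within A xs"
  "stops_within A (xs @ ys) \<longleftrightarrow> stops_within A xs \<and> stops_within A ys"
  unfolding stops_within_def by fastforce+

lemma stops_within_picks [simp]: "stops_within A (picks B) \<longleftrightarrow> snd ` set B \<subseteq> A"
  by (force simp: stops_within_def)

lemma stops_within_stops [simp]: "stops_within A (stops Bs) \<longleftrightarrow> snd ` set (concat Bs) \<subseteq> A"
  by (force simp: stops_within_def Pick_in_stops)

lemma release_ge: "t \<le> release r x t"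
  by (cases x) auto

lemma release_mono: "s \<le> t \<Longrightarrow> release r x s \<le> release r x t"
  by (cases x) auto

context valid_warehouse
begin

lemma stop_loc_in_grid:
  "p \<in> grid w \<Longrightarrow> stops_within (grid w) (x # xs) \<Longrightarrow> stop_loc sys w p x \<in> grid w"
  by (cases x) (auto simp: depot_in_grid)

lemma stops_within_ConsD: "stops_within A (x # xs) \<Longrightarrow> stops_within A xs"
  by (auto simp: stops_within_def)

lemma end_loc_in_grid:
  "p \<in> grid w \<Longrightarrow> stops_within (grid w) xs \<Longrightarrow> end_loc sys w p xs \<in> grid w"
proof (induction xs arbitrary: p)
  case (Cons x xs)
  then show ?case
    using Cons.IH[OF stop_loc_in_grid] stops_within_ConsD by auto
qed simp

lemma tour_nonneg: "p \<in> grid w \<Longrightarrow> stops_within (grid w) xs \<Longrightarrow> 0 \<le> tour sys w p xs"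
proof (induction xs arbitrary: p)
  case (Cons x xs)
  note q = stop_loc_in_grid[OF Cons.prems, of sys]
  have "0 \<le> tour sys w (stop_loc sys w p x) xs"
    using Cons.IH[OF q] Cons.prems(2) stops_within_ConsD by blast
  then show ?case using wdist_nonneg[OF Cons.prems(1) q] by simp
qed simp

text \<open>A picker who is at \<open>q\<close> at time \<open>T\<close> is ahead of one who is at \<open>p\<close> at time \<open>t\<close> if she can be at \<open>p\<close>
  by time \<open>t\<close>. By the triangle inequality, she is still ahead after a stop that both of them make, and also after
  a stop that only the other one makes. This single comparison serves to restrict a solution to the items
  that are still to be picked, to drop empty batches, and to compare the actual course of the policy with
  the offline optimum.\<close>

lemma completion_subseq:
  assumes "subseq ys xs" "T + wdist w q p \<le> t" "p \<in> grid w" "q \<in> grid w"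
    and "stops_within (grid w) xs"
  shows "completion sys w r T q ys + wdist w (end_loc sys w q ys) (end_loc sys w p xs)
           \<le> completion sys w r t p xs"
  using assms
proof (induction xs arbitrary: ys T q t p rule: list.induct)
  case (Cons x xs)
  define p' where "p' = stop_loc sys w p x"
  have p': "p' \<in> grid w" unfolding p'_def using Cons.prems by (intro stop_loc_in_grid)
  have xs: "stops_within (grid w) xs" using Cons.prems(5) stops_within_ConsD by blast
  show ?case
  proof (cases "subseq ys xs")
    case True
    \<comment> \<open>The stop \<open>x\<close> is skipped: the first picker stays at \<open>q\<close> at time \<open>T\<close>.\<close>
    have "T + wdist w q p' \<le> release r x (t + wdist w p p')"
      using Cons.prems(2) wdist_triangle[OF Cons.prems(4,3) p'] release_ge order_trans
      by (smt (verit))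
    from Cons.IH[OF True this p' Cons.prems(4) xs] show ?thesis
      by (simp add: completion_Cons p'_def del: completion.simps(2,3))
  next
    case False
    with Cons.prems(1) obtain zs where ys: "ys = x # zs" and zs: "subseq zs xs"
      by (cases rule: list_emb.cases) auto
    define q' where "q' = stop_loc sys w q x"
    have q': "q' \<in> grid w" unfolding q'_def using Cons.prems by (intro stop_loc_in_grid)
    have "release r x (T + wdist w q q') + wdist w q' p' \<le> release r x (t + wdist w p p')"
    proof (cases "q' = p'")
      case True
      have "T + wdist w q p' \<le> t + wdist w p p'"
        using Cons.prems(2) wdist_triangle[OF Cons.prems(4,3) p'] by simp
      then show ?thesis using True p' by (simp add: release_mono)
    next
      case False
      \<comment> \<open>Only the change of robots is a stop whose location depends on the picker.\<close>
      then have "x = Finish" "q' = q" "p' = p"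
        by (cases x; auto simp: p'_def q'_def split: if_splits)+
      then show ?thesis using Cons.prems by simp
    qed
    from Cons.IH[OF zs this p' q' xs] show ?thesis
      by (simp add: ys completion_Cons p'_def q'_def del: completion.simps(2,3))
  qed
qed (auto dest: list_emb_Nil2)

lemma completion_ge_tour: "t + tour sys w p xs \<le> completion sys w r t p xs"
proof (induction xs arbitrary: t p)
  case (Cons x xs)
  show ?case
    using Cons.IH[of "release r x (t + wdist w p (stop_loc sys w p x))" "stop_loc sys w p x"]
      release_ge[of "t + wdist w p (stop_loc sys w p x)" r x]
    by (simp add: completion_Cons del: completion.simps(2,3))
qed simp

lemma completion_eq_tour:
  assumes "\<And>j s. Pick j s \<in> set xs \<Longrightarrow> r j \<le> t" "p \<in> grid w" "stops_within (grid w) xs"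
  shows "completion sys w r t p xs = t + tour sys w p xs"
  using assms
proof (induction xs arbitrary: t p)
  case (Cons x xs)
  define q where "q = stop_loc sys w p x"
  have q: "q \<in> grid w" unfolding q_def using Cons.prems by (intro stop_loc_in_grid)
  have "release r x (t + wdist w p q) = t + wdist w p q"
    using Cons.prems(1) wdist_nonneg[OF Cons.prems(2) q] by (cases x) force+
  moreover have "completion sys w r (t + wdist w p q) q xs = (t + wdist w p q) + tour sys w q xs"
  proof (rule Cons.IH)
    show "r j \<le> t + wdist w p q" if "Pick j s \<in> set xs" for j s
      using Cons.prems(1)[of j s] that wdist_nonneg[OF Cons.prems(2) q] by auto
  qed (use q Cons.prems(3) stops_within_ConsD in auto)
  ultimately show ?case by (simp add: completion_Cons q_def del: completion.simps(2,3))
qed simp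

lemma tour_subseq:
  assumes "subseq ys xs" "p \<in> grid w" "q \<in> grid w" "stops_within (grid w) xs"
  shows "tour sys w q ys \<le> wdist w q p + tour sys w p xs"
proof -
  have ys: "stops_within (grid w) ys"
    using assms(1,4) by (auto simp: stops_within_def elim: list_emb_set)
  have "completion sys w (\<lambda>_. 0) 0 q ys + wdist w (end_loc sys w q ys) (end_loc sys w p xs)
      \<le> completion sys w (\<lambda>_. 0) (wdist w q p) p xs"
    using assms by (intro completion_subseq) auto
  moreover have "completion sys w (\<lambda>_. 0) 0 q ys = tour sys w q ys"
    using assms ys by (subst completion_eq_tour) auto
  moreover have "completion sys w (\<lambda>_. 0) (wdist w q p) p xs = wdist w q p + tour sys w p xs"
    using assms wdist_nonneg by (subst completion_eq_tour) auto
  ultimately show ?thesis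
    using wdist_nonneg[of "end_loc sys w q ys" "end_loc sys w p xs"] end_loc_in_grid assms ys
    by auto
qed

lemma completion_ge_start:
  assumes "p \<in> grid w" "stops_within (grid w) xs"
  shows "t \<le> completion sys w r t p xs"
  using completion_ge_tour[of t sys p xs r] tour_nonneg[OF assms, of sys] by simp

lemma completion_ge_release:
  assumes "Pick j s \<in> set xs" "p \<in> grid w" "stops_within (grid w) xs"
  shows "r j \<le> completion sys w r t p xs"
proof -
  obtain us vs where xs: "xs = us @ Pick j s # vs" using assms(1) by (meson split_list)
  let ?q = "end_loc sys w p us"
  let ?t = "max (completion sys w r t p us + wdist w ?q s) (r j)"
  have "?t \<le> completion sys w r ?t s vs"
    using assms xs by (intro completion_ge_start) auto
  then show ?thesis by (simp add: xs)
qed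

end

section \<open>Bounds on tours\<close>

lemma subseq_pair:
  "x \<in> set xs \<Longrightarrow> y \<in> set xs \<Longrightarrow> x \<noteq> y \<Longrightarrow> subseq [x, y] xs \<or> subseq [y, x] xs"
  by (induction xs) (auto simp: subseq_singleton_left)

context valid_warehouse
begin

text \<open>An aisle is walked from one end to the other.\<close>

lemma tour_along_aisle:
  assumes "sorted (map (snd \<circ> snd) B)" "\<forall>(j, s) \<in> set B. fst s = x \<and> s \<in> in_aisle w \<and> y \<le> snd s"
    and "(x, y) \<in> in_aisle w"
  shows "tour sys w (x, y) (picks B) \<le> wh_width w - y"
  using assms
proof (induction B arbitrary: y)
  case Nil
  then show ?case by (auto simp: in_aisle_def)
next
  case (Cons b B)
  obtain j y' where b: "b = (j, (x, y'))" using Cons.prems(2) by (cases b) auto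
  have y': "(x, y') \<in> in_aisle w" "y \<le> y'" using Cons.prems(2) by (auto simp: b)
  have "tour sys w (x, y') (picks B) \<le> wh_width w - y'"
    using Cons.prems y' by (intro Cons.IH) (auto simp: b)
  then show ?case
    using wdist_in_aisle[OF Cons.prems(3) y'(1)] y'(2) by (simp add: b)
qed

lemma traverse_aisle:
  assumes "finite X" "\<forall>(j, s) \<in> X. fst s = x \<and> s \<in> in_aisle w"
  shows "\<exists>B. distinct B \<and> set B = X \<and>
           (\<forall>p \<in> grid w. tour sys w p (picks B) \<le> diameter_bound + wh_width w)"
proof -
  obtain B0 where B0: "set B0 = X" "distinct B0" using finite_distinct_list[OF assms(1)] by blast
  define B where "B = sort_key (snd \<circ> snd) B0"
  have B: "set B = X" "distinct B" "sorted (map (snd \<circ> snd) B)"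
    using B0 by (auto simp: B_def)
  have "tour sys w p (picks B) \<le> diameter_bound + wh_width w" if p: "p \<in> grid w" for p
  proof (cases B)
    case Nil
    then show ?thesis using diameter_bound_nonneg wh_width_nonneg by simp
  next
    case (Cons b B')
    obtain j y where b: "b = (j, (x, y))" and y: "(x, y) \<in> in_aisle w"
      using assms(2) B(1) Cons by (cases b) auto
    have "tour sys w (x, y) (picks B') \<le> wh_width w - y"
      using B assms(2) y Cons by (intro tour_along_aisle) (auto simp: b)
    moreover have "wdist w p (x, y) \<le> diameter_bound"
      using p y in_aisle_subset_grid by (intro wdist_le_diameter) auto
    moreover have "0 \<le> y" using y by (auto simp: in_aisle_def)
    ultimately show ?thesis by (simp add: Cons b)
  qed
  then show ?thesis using B by blast
qed

definition traversal_bound :: real where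
  "traversal_bound = real (aisles w) * (diameter_bound + wh_width w)"

lemma traversal_bound_nonneg: "0 \<le> traversal_bound"
  using diameter_bound_nonneg wh_width_nonneg by (simp add: traversal_bound_def)

text \<open>One aisle after the other, with a free move from each aisle to the next. The induction is on the
  number of aisles that may contain items.\<close>

lemma traverse_aisles:
  assumes "finite X" "\<forall>(j, s) \<in> X. s \<in> in_aisle w \<and>
             (\<exists>i < k. fst s = real i * wh_length w / real (aisles w - 1))"
  shows "\<exists>B. distinct B \<and> set B = X \<and>
           (\<forall>p \<in> grid w. tour sys w p (picks B) \<le> real k * (diameter_bound + wh_width w))"
  using assms
proof (induction k arbitrary: X)
  case 0
  then show ?case by (auto intro!: exI[of _ "[]"])
next
  case (Suc k)
  define x where "x = real k * wh_length w / real (aisles w - 1)"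
  define X1 where "X1 = {b \<in> X. fst (snd b) \<noteq> x}"
  define X2 where "X2 = {b \<in> X. fst (snd b) = x}"
  have X1: "\<forall>(j, s) \<in> X1. s \<in> in_aisle w \<and>
      (\<exists>i < k. fst s = real i * wh_length w / real (aisles w - 1))"
  proof clarify
    fix j a b assume X1: "(j, (a, b)) \<in> X1"
    then obtain i where i: "i < Suc k" "a = real i * wh_length w / real (aisles w - 1)"
      using Suc.prems(2) by (fastforce simp: X1_def)
    moreover have "i \<noteq> k" using X1 i by (auto simp: X1_def x_def)
    ultimately show "(a, b) \<in> in_aisle w \<and>
        (\<exists>i < k. fst (a, b) = real i * wh_length w / real (aisles w - 1))"
      using X1 Suc.prems(2) by (auto simp: X1_def intro!: exI[of _ i])
  qed
  have "finite X1" using Suc.prems by (simp add: X1_def)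
  from Suc.IH[OF this X1] obtain B1 where B1: "distinct B1" "set B1 = X1"
    "\<forall>p \<in> grid w. tour sys w p (picks B1) \<le> real k * (diameter_bound + wh_width w)"
    by blast
  have "\<forall>(j, s) \<in> X2. fst s = x \<and> s \<in> in_aisle w" "finite X2"
    using Suc.prems by (auto simp: X2_def)
  from traverse_aisle[OF this(2,1)] obtain B2 where B2: "distinct B2" "set B2 = X2"
    "\<forall>p \<in> grid w. tour sys w p (picks B2) \<le> diameter_bound + wh_width w"
    by blast
  have "tour sys w p (picks (B1 @ B2)) \<le> real (Suc k) * (diameter_bound + wh_width w)"
    if p: "p \<in> grid w" for p
  proof -
    have "end_loc sys w p (picks B1) \<in> grid w"
      using p B1(2) Suc.prems(2) in_aisle_subset_grid
      by (intro end_loc_in_grid) (auto simp: X1_def)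
    then show ?thesis using B1(3) B2(3) p by (fastforce simp: algebra_simps)
  qed
  moreover have "distinct (B1 @ B2)" "set (B1 @ B2) = X"
    using B1 B2 by (auto simp: X1_def X2_def)
  ultimately show ?case by blast
qed

text \<open>The number of items does not matter: all of them are met on one walk through the grid.\<close>

lemma traverse_items:
  assumes "finite X" "snd ` X \<subseteq> in_aisle w"
  shows "\<exists>B. distinct B \<and> set B = X \<and> (\<forall>p \<in> grid w. tour sys w p (picks B) \<le> traversal_bound)"
  unfolding traversal_bound_def
proof (rule traverse_aisles[OF assms(1)], clarify)
  fix j a b assume "(j, (a, b)) \<in> X"
  then have "(a, b) \<in> in_aisle w" using assms(2) by force
  then show "(a, b) \<in> in_aisle w \<and>
      (\<exists>i < aisles w. fst (a, b) = real i * wh_length w / real (aisles w - 1))"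
    by (auto simp: in_aisle_def)
qed

lemma tour_eq_0_at_depot:
  assumes "stops_within {depot w} xs"
  shows "tour sys w (depot w) xs = 0" "end_loc sys w (depot w) xs = depot w"
proof -
  have "stop_loc sys w (depot w) x = depot w" if "x \<in> set xs" for x
  proof (cases x)
    case (Pick j s)
    then have "s = depot w" using that assms unfolding stops_within_def by blast
    then show ?thesis by (simp add: Pick)
  qed simp
  then show "tour sys w (depot w) xs = 0" "end_loc sys w (depot w) xs = depot w"
    using depot_in_grid by (induction xs) auto
qed

lemma end_loc_stops_pushcart [simp]:
  "sys \<noteq> Robot \<Longrightarrow> end_loc sys w (depot w) (stops Bs) = depot w"
  by (induction Bs) auto

lemma tour_stops_pushcart:
  "sys \<noteq> Robot \<Longrightarrow> tour sys w (depot w) (stops Bs) =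
     (\<Sum>B\<leftarrow>Bs. tour sys w (depot w) (stops [B]))"
  by (induction Bs) auto

text \<open>An order that forces a batch to travel: with robots one whose own items are apart, with a
  pushcart one with an item away from the depot.\<close>

definition wide :: "system \<Rightarrow> real \<Rightarrow> order_list \<Rightarrow> bool" where
  "wide sys \<delta> xs \<longleftrightarrow> (\<exists>s \<in> set xs. \<exists>s' \<in> (if sys = Robot then set xs else {depot w}). \<delta> \<le> dist s s')"

lemma tour_ge_dist_subseq:
  assumes "subseq [x, y] xs" "p \<in> grid w" "stops_within (grid w) xs"
    and "\<And>q. stop_loc sys w q x = s" "\<And>q. stop_loc sys w q y = s'"
  shows "dist s s' \<le> tour sys w p xs"
proof -
  have xy: "stops_within (grid w) [x, y]"
    using assms(1,3) by (auto simp: stops_within_def elim: list_emb_set)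
  have s: "s \<in> grid w" using stop_loc_in_grid[OF assms(2) xy] assms(4) by metis
  have s': "s' \<in> grid w"
    using stop_loc_in_grid[OF assms(2) stops_within_ConsD[OF xy]] assms(5) by metis
  have "wdist w p s + wdist w s s' \<le> tour sys w p xs"
    using tour_subseq[OF assms(1,2,2,3), of sys] assms(2,4,5) by simp
  then show ?thesis using dist_le_wdist[OF s s'] wdist_nonneg[OF assms(2) s] by simp
qed

text \<open>The two far points are both visited within the batch, in one sequence or the other; with a
  pushcart the second one is the depot, to which the batch returns. Since only the way between
  them is counted, the bound holds wherever the picker starts.\<close>

lemma tour_ge_wide:
  assumes "wide sys \<delta> xs" "0 < \<delta>" "\<forall>s \<in> set xs. (j, s) \<in> set B"
    and "p \<in> grid w" "snd ` set B \<subseteq> grid w"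
  shows "\<delta> \<le> tour sys w p (stops [B])"
proof -
  obtain s s' where s: "s \<in> set xs" "s' \<in> (if sys = Robot then set xs else {depot w})" "\<delta> \<le> dist s s'"
    using assms(1) by (auto simp: wide_def)
  have B: "stops_within (grid w) (stops [B])" using assms(5) by simp
  have "dist s s' \<le> tour sys w p (stops [B])"
  proof (cases "sys = Robot")
    case True
    then have "(j, s) \<in> set B" "(j, s') \<in> set B" "s \<noteq> s'" using s assms(2,3) by auto
    then have "subseq [(j, s), (j, s')] B \<or> subseq [(j, s'), (j, s)] B"
      by (intro subseq_pair) auto
    then have "subseq [Pick j s, Pick j s'] (stops [B]) \<or> subseq [Pick j s', Pick j s] (stops [B])"
      using subseq_map[of _ B "\<lambda>(j, s). Pick j s"] by (fastforce intro: subseq_rev_drop_many)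
    then show ?thesis
      using tour_ge_dist_subseq[OF _ assms(4) B, of "Pick j s" "Pick j s'" sys s s']
        tour_ge_dist_subseq[OF _ assms(4) B, of "Pick j s'" "Pick j s" sys s' s]
      by (auto simp: dist_commute)
  next
    case False
    have "subseq [(j, s)] B" using s(1) assms(3) by (simp add: subseq_singleton_left)
    from subseq_map[OF this, of "\<lambda>(j, s). Pick j s"]
    have "subseq ([Pick j s] @ [Finish]) (picks B @ [Finish])"
      by (subst subseq_append) simp
    then show ?thesis
      using tour_ge_dist_subseq[OF _ assms(4) B, of "Pick j s" Finish sys s "depot w"] False s(2)
      by simp
  qed
  then show ?thesis using s(3) by simp
qed

end

section \<open>Schedules\<close>

text \<open>A solution that may contain empty batches. They arise from carts that are still empty when a
  history is cut off, and from plans that leave the rest of the current batch empty.\<close>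

definition schedule :: "warehouse \<Rightarrow> inst \<Rightarrow> batch list \<Rightarrow> bool" where
  "schedule w I Bs \<longleftrightarrow> distinct (concat Bs) \<and> set (concat Bs) = items I
                       \<and> cart_loads w (map batch_orders Bs)"

definition valid_inst :: "warehouse \<Rightarrow> inst \<Rightarrow> bool" where
  "valid_inst w I \<longleftrightarrow> sorted (map fst I) \<and> (\<forall>(r, xs) \<in> set I. 0 \<le> r \<and> is_order w xs)"

lemma solution_iff_schedule: "solution w I Bs \<longleftrightarrow> [] \<notin> set Bs \<and> schedule w I Bs"
  by (auto simp: solution_def schedule_def)

lemma batch_orders_simps [simp]:
  "batch_orders [] = {}"
  "batch_orders (b # B) = insert (fst b) (batch_orders B)"
  "batch_orders (B @ C) = batch_orders B \<union> batch_orders C"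
  by (auto simp: batch_orders_def)

lemma items_take: "items (take k I) = {b \<in> items I. fst b < k}"
  by (auto simp: items_def)

lemma finite_items: "finite (items I)"
proof -
  have "items I = (\<Union>j<length I. Pair j ` set (snd (I ! j)))" by (auto simp: items_def)
  then show ?thesis by simp
qed

lemma concat_nonempty: "concat (filter (\<lambda>B. B \<noteq> []) Bs) = concat Bs"
  by (induction Bs) auto

lemma subseq_concat_map: "(\<And>x. x \<in> set xs \<Longrightarrow> subseq (f x) (g x)) \<Longrightarrow> subseq (concat (map f xs)) (concat (map g xs))"
  by (induction xs) (simp_all add: list_emb_append_mono)

lemma stops_nonempty_subseq: "subseq (stops (filter (\<lambda>B. B \<noteq> []) Bs)) (stops Bs)"
  by (induction Bs) (auto simp: subseq_append')

lemma stops_restrict_subseq: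
  "subseq (stops (filter (\<lambda>B. B \<noteq> []) (map (filter P) Bs))) (stops Bs)"
proof -
  have "subseq (stops (map (filter P) Bs)) (stops Bs)"
    unfolding stops_def map_map o_def
    by (rule subseq_concat_map) (simp add: subseq_map)
  then show ?thesis using stops_nonempty_subseq subseq_order.order_trans by blast
qed

lemma cart_loads_append:
  "cart_loads w (Xs @ Ys) \<longleftrightarrow>
     cart_loads w Xs \<and> cart_loads w Ys \<and> (\<forall>X \<in> set Xs. \<forall>Y \<in> set Ys. X \<inter> Y = {})"
  by (auto simp: cart_loads_def sorted_wrt_append)

lemma cart_loads_Cons:
  "cart_loads w (X # Xs) \<longleftrightarrow>
     finite X \<and> card X \<le> capacity w \<and> cart_loads w Xs \<and> (\<forall>Y \<in> set Xs. X \<inter> Y = {})"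
  by (auto simp: cart_loads_def)

lemma cart_loads_Nil [simp]: "cart_loads w []"
  by (simp add: cart_loads_def)

lemma cart_loads_mono:
  assumes "cart_loads w (map f Bs)" "\<And>B. B \<in> set Bs \<Longrightarrow> g B \<subseteq> f B"
  shows "cart_loads w (map g Bs)"
proof -
  have "card (g B) \<le> capacity w" "finite (g B)" if "B \<in> set Bs" for B
  proof -
    have "finite (f B)" "card (f B) \<le> capacity w"
      using assms(1) that by (auto simp: cart_loads_def)
    then show "card (g B) \<le> capacity w" "finite (g B)"
      using assms(2)[OF that] card_mono[of "f B" "g B"] finite_subset[of "g B" "f B"] by auto
  qed
  moreover have "sorted_wrt (\<lambda>B C. g B \<inter> g C = {}) Bs"
  proof (rule sorted_wrt_mono_rel)
    show "sorted_wrt (\<lambda>B C. f B \<inter> f C = {}) Bs"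
      using assms(1) by (simp add: cart_loads_def sorted_wrt_map)
  qed (use assms(2) in blast)
  ultimately show ?thesis by (auto simp: cart_loads_def sorted_wrt_map)
qed

lemma cart_loads_nonempty:
  "cart_loads w (map f Bs) \<Longrightarrow> cart_loads w (map f (filter P Bs))"
  by (auto simp: cart_loads_def sorted_wrt_map sorted_wrt_filter)

lemma solution_nonempty_batches:
  "schedule w I Bs \<Longrightarrow> solution w I (filter (\<lambda>B. B \<noteq> []) Bs)"
  by (simp add: solution_def schedule_def concat_nonempty cart_loads_nonempty)

lemma schedule_insert_Nil: "schedule w I (As @ Bs) \<Longrightarrow> schedule w I (As @ [] # Bs)"
  by (auto simp: schedule_def cart_loads_append cart_loads_Cons)

text \<open>No order is split between batches, so an order of a finished batch has been picked completely.\<close>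

lemma schedule_prefix_complete:
  assumes "schedule w J (Ds @ Bs)" "j \<in> fst ` set (concat Ds)" "(j, s) \<in> items J"
  shows "(j, s) \<in> set (concat Ds)"
proof (rule ccontr)
  assume "(j, s) \<notin> set (concat Ds)"
  then obtain B where B: "B \<in> set Bs" "(j, s) \<in> set B"
    using assms(1,3) by (auto simp: schedule_def)
  then have "j \<in> batch_orders B" by (force simp: batch_orders_def)
  moreover obtain D where "D \<in> set Ds" "j \<in> batch_orders D"
    using assms(2) by (auto simp: batch_orders_def)
  moreover have "batch_orders D \<inter> batch_orders B = {}"
    using assms(1) B(1) \<open>D \<in> set Ds\<close> by (simp add: schedule_def cart_loads_append)
  ultimately show False by blast
qed

lemma schedule_batch_complete:
  assumes "schedule w J Bs" "B \<in> set Bs" "j \<in> batch_orders B" "(j, s) \<in> items J"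
  shows "(j, s) \<in> set B"
proof -
  obtain Ds Es where Bs: "Bs = Ds @ B # Es" using assms(2) by (meson split_list)
  have "batch_orders D \<inter> batch_orders B = {}" if "D \<in> set Ds \<union> set Es" for D
    using assms(1) that by (auto simp: Bs schedule_def cart_loads_append cart_loads_Cons)
  moreover have "j \<in> batch_orders D" if "(j, s) \<in> set D" for D
    using that by (force simp: batch_orders_def)
  ultimately have "(j, s) \<notin> set D" if "D \<in> set Ds \<union> set Es" for D
    using that assms(3) by blast
  moreover have "(j, s) \<in> set (concat Bs)" using assms(1,4) by (simp add: schedule_def)
  ultimately show ?thesis by (auto simp: Bs)
qed

text \<open>Each order can be served by a batch of its own.\<close>

lemma solution_exists:
  assumes "is_warehouse w" "\<forall>(r, xs) \<in> set I. is_order w xs"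
  shows "\<exists>Bs. solution w I Bs"
proof -
  define b where "b = (\<lambda>j. map (Pair j) (snd (I ! j)))"
  have ord: "is_order w (snd (I ! j))" if "j < length I" for j
    using assms(2) nth_mem[OF that] by (force simp: case_prod_beta)
  have bo: "batch_orders (b j) \<subseteq> {j}" for j by (auto simp: b_def batch_orders_def)
  have card: "card (batch_orders (b j)) \<le> capacity w \<and> finite (batch_orders (b j))" for j
    using card_mono[OF _ bo, of j] finite_subset[OF bo, of j] assms(1) by (auto simp: is_warehouse_def)
  have "distinct (concat (map b [0..<n]))" if "n \<le> length I" for n
    using that
  proof (induction n)
    case (Suc n)
    then have "distinct (b n)"
      using ord[of n] by (simp add: b_def distinct_map inj_on_def is_order_def)
    then show ?case using Suc by (auto simp: b_def)
  qed simp
  moreover have "set (concat (map b [0..<length I])) = items I"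
    by (auto simp: items_def b_def)
  moreover have "cart_loads w (map batch_orders (map b [0..<length I]))"
  proof -
    have "sorted_wrt (\<lambda>i j. batch_orders (b i) \<inter> batch_orders (b j) = {}) [0..<length I]"
    proof (rule sorted_wrt_mono_rel[OF _ sorted_wrt_upt])
      fix i j :: nat assume "i < j"
      then show "batch_orders (b i) \<inter> batch_orders (b j) = {}" using bo[of i] bo[of j] by auto
    qed
    then show ?thesis using card by (auto simp: cart_loads_def sorted_wrt_map)
  qed
  ultimately have "schedule w I (map b [0..<length I])" by (simp add: schedule_def)
  moreover have "b j \<noteq> []" if "j < length I" for j
    using ord[OF that] by (simp add: b_def is_order_def)
  then have "[] \<notin> set (map b [0..<length I])" by force
  ultimately show ?thesis unfolding solution_iff_schedule by blast
qed

lemma arrived_by_eq_take: "arrived_by I t = take (length (arrived_by I t)) I"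
  unfolding arrived_by_def by (rule takeWhile_eq_take)

lemma length_arrived_by: "length (arrived_by I t) \<le> length I"
  by (simp add: arrived_by_def length_takeWhile_le)

lemma nth_arrived_by: "j < length (arrived_by I t) \<Longrightarrow> fst (I ! j) \<le> t"
  using set_takeWhileD[OF nth_mem, of j "\<lambda>(r, xs). r \<le> t" I] takeWhile_nth[of j "\<lambda>(r, xs). r \<le> t" I]
  by (simp add: arrived_by_def case_prod_beta)

lemma not_arrived_by:
  assumes "length (arrived_by I t) < length I"
  shows "t < fst (I ! length (arrived_by I t))"
  using nth_length_takeWhile[OF assms[unfolded arrived_by_def]]
  by (simp add: arrived_by_def case_prod_beta)

lemma arrived_by_mono:
  assumes "t \<le> u"
  shows "length (arrived_by I t) \<le> length (arrived_by I u)"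
proof (rule ccontr)
  assume "\<not> ?thesis"
  then have *: "length (arrived_by I u) < length (arrived_by I t)" by simp
  then have "length (arrived_by I u) < length I" using length_arrived_by[of I t] by simp
  from not_arrived_by[OF this] nth_arrived_by[OF *] assms show False by simp
qed

lemma valid_instD:
  assumes "valid_inst w I" "j < length I"
  shows "0 \<le> fst (I ! j)" "is_order w (snd (I ! j))"
    and "i \<le> j \<Longrightarrow> fst (I ! i) \<le> fst (I ! j)"
proof -
  show "0 \<le> fst (I ! j)" "is_order w (snd (I ! j))"
    using assms nth_mem[OF assms(2)] by (auto simp: valid_inst_def case_prod_beta)
  show "fst (I ! i) \<le> fst (I ! j)" if "i \<le> j"
    using assms that sorted_nth_mono[of "map fst I" i j] by (simp add: valid_inst_def)
qed

lemma valid_inst_items: "valid_inst w I \<Longrightarrow> snd ` items I \<subseteq> in_aisle w"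
  by (auto simp: items_def is_order_def dest!: valid_instD(2))

lemma arrived_by_all:
  assumes "valid_inst w I" "\<And>r xs. (r, xs) \<in> set I \<Longrightarrow> r \<le> t"
  shows "arrived_by I t = I"
  using assms by (auto simp: arrived_by_def takeWhile_eq_all_conv)

text \<open>The policy is in a legitimate situation when what it has done so far, namely the finished
  batches \<open>Ds\<close> and the items \<open>C\<close> in the current cart, is the beginning of a schedule for the first
  \<open>k\<close> orders; a feasible plan then turns this beginning into a schedule for all arrived orders.\<close>

definition history_situation :: "inst \<Rightarrow> real \<Rightarrow> loc \<Rightarrow> batch list \<Rightarrow> batch \<Rightarrow> situation" where
  "history_situation I t p Ds C =
     \<lparr>now = t, arrived = arrived_by I t, position = p, cart = batch_orders C,
      picked = set (concat Ds) \<union> set C\<rparr>"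

text \<open>An order that has been commenced but not completed cannot belong to a finished batch, so it is
  in the current cart.\<close>

lemma is_situation_history:
  assumes I: "valid_inst w I" and k: "k \<le> length (arrived_by I t)"
    and sch: "schedule w (take k I) (Ds @ (C @ X) # Y)" and p: "p \<in> grid w"
  shows "is_situation w (history_situation I t p Ds C)"
proof -
  let ?A = "arrived_by I t" and ?P = "set (concat Ds) \<union> set C"
  have sub: "?P \<subseteq> items (take k I)" using sch by (auto simp: schedule_def)
  have items_k: "b \<in> items (take k I)" if "b \<in> items ?A" "fst b < k" for b
    using that by (subst (asm) arrived_by_eq_take) (auto simp: items_take)
  have sub': "?P \<subseteq> items ?A"
    using sub k by (subst arrived_by_eq_take) (auto simp: items_take)
  have "sorted (map fst ?A)"
    using I by (subst arrived_by_eq_take) (auto simp: valid_inst_def take_map[symmetric] sorted_wrt_take)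
  moreover have "\<forall>(r, xs) \<in> set ?A. 0 \<le> r \<and> r \<le> t \<and> is_order w xs"
    using I by (auto simp: arrived_by_def valid_inst_def dest: set_takeWhileD)
  moreover have "card (batch_orders C) \<le> capacity w"
  proof -
    have "finite (batch_orders (C @ X))" "card (batch_orders (C @ X)) \<le> capacity w"
      using sch by (auto simp: schedule_def cart_loads_append cart_loads_Cons)
    then show ?thesis
      using card_mono[of "batch_orders (C @ X)" "batch_orders C"] by simp
  qed
  moreover have "j \<in> batch_orders C"
    if "(j, s) \<in> items ?A" "(j, s) \<notin> ?P" "j \<in> fst ` ?P" for j s
  proof -
    have "j < k" using that(3) sub by (auto simp: items_take)
    then have "(j, s) \<in> items (take k I)" using items_k that(1) by simp
    then have "j \<notin> fst ` set (concat Ds)" using schedule_prefix_complete[OF sch] that(2) by blast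
    then show ?thesis using that(3) by (auto simp: batch_orders_def)
  qed
  then have "\<forall>(j, s) \<in> items ?A - ?P. j \<in> fst ` ?P \<longrightarrow> j \<in> batch_orders C" by blast
  moreover have "batch_orders C \<subseteq> fst ` ?P" by (auto simp: batch_orders_def)
  ultimately show ?thesis
    using sub' p unfolding is_situation_def history_situation_def situation.select_convs by blast
qed

text \<open>The remaining items of commenced orders belong to the current cart; hence the plan
  adds nothing to the orders of finished batches, and the loads stay disjoint.\<close>

lemma schedule_history_plan:
  assumes I: "valid_inst w I" and k: "k \<le> length (arrived_by I t)"
    and sch: "schedule w (take k I) (Ds @ (C @ X) # Y)" and p: "p \<in> grid w"
    and \<pi>: "feasible_plan w (history_situation I t p Ds C) \<pi>"
  shows "schedule w (arrived_by I t) (Ds @ (C @ current \<pi>) # later \<pi>)"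
proof -
  define A P where "A = arrived_by I t" and "P = set (concat Ds) \<union> set C"
  define Bs where "Bs = current \<pi> # later \<pi>"
  have sit: "P \<subseteq> items A" "\<And>j s. (j, s) \<in> items A - P \<Longrightarrow> j \<in> fst ` P \<Longrightarrow> j \<in> batch_orders C"
    using is_situation_history[OF I k sch p]
    unfolding is_situation_def history_situation_def situation.select_convs A_def P_def by blast+
  have plan: "distinct (concat Bs)" "set (concat Bs) = items A - P"
    "cart_loads w ((batch_orders C \<union> batch_orders (current \<pi>)) # map batch_orders (later \<pi>))"
    using \<pi> by (simp_all add: feasible_plan_def history_situation_def Bs_def A_def P_def)
  have old: "distinct (concat Ds)" "distinct C" "set (concat Ds) \<inter> set C = {}"
    "cart_loads w (map batch_orders Ds)" "\<And>D. D \<in> set Ds \<Longrightarrow> batch_orders D \<inter> batch_orders C = {}"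
    using sch by (auto simp: schedule_def cart_loads_append)
  have disjoint: "batch_orders D \<inter> batch_orders B = {}"
    if D: "D \<in> set Ds" and B: "B \<in> set ((C @ current \<pi>) # later \<pi>)" for D B
  proof -
    have "j \<notin> batch_orders B'" if j: "j \<in> batch_orders D" and B': "B' \<in> set Bs" for j B'
    proof
      assume "j \<in> batch_orders B'"
      then obtain s where "(j, s) \<in> set B'" by (auto simp: batch_orders_def)
      then have "(j, s) \<in> set (concat Bs)" using B' by auto
      moreover have "j \<in> fst ` P"
        using j D by (auto simp: P_def batch_orders_def)
      ultimately have "j \<in> batch_orders C" using sit(2) plan(2) by blast
      then show False using old(5)[OF D] j by blast
    qed
    then show ?thesis using B old(5)[OF D] by (auto simp: Bs_def)
  qed
  have new: "set (concat (Ds @ (C @ current \<pi>) # later \<pi>)) = P \<union> set (concat Bs)"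
    "concat (Ds @ (C @ current \<pi>) # later \<pi>) = concat Ds @ C @ concat Bs"
    by (auto simp: P_def Bs_def)
  have "(set (concat Ds) \<union> set C) \<inter> set (concat Bs) = {}"
    unfolding plan(2) P_def by blast
  then have "distinct (concat (Ds @ (C @ current \<pi>) # later \<pi>))"
    unfolding new(2) using old(1-3) plan(1) by (simp only: distinct_append set_append) blast
  moreover have "set (concat (Ds @ (C @ current \<pi>) # later \<pi>)) = items A"
    unfolding new(1) plan(2) using sit(1) by blast
  moreover have "cart_loads w (map batch_orders (Ds @ (C @ current \<pi>) # later \<pi>))"
  proof -
    have "batch_orders D \<inter> Y = {}"
      if D: "D \<in> set Ds" and Y: "Y \<in> set (map batch_orders ((C @ current \<pi>) # later \<pi>))" for D Y
    proof -
      obtain B where B: "Y = batch_orders B" "B \<in> set ((C @ current \<pi>) # later \<pi>)"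
        using Y unfolding list.set_map by (rule imageE)
      then show ?thesis using disjoint[OF D B(2)] by simp
    qed
    then have "\<forall>X \<in> set (map batch_orders Ds).
        \<forall>Y \<in> set (map batch_orders ((C @ current \<pi>) # later \<pi>)). X \<inter> Y = {}"
      unfolding list.set_map[of batch_orders Ds] by blast
    then show ?thesis
      unfolding map_append cart_loads_append using old(4) plan(3) by simp
  qed
  ultimately show ?thesis
    unfolding schedule_def A_def by (intro conjI)
qed

section \<open>Optimal plans\<close>

context valid_warehouse
begin

lemma stops_within_plan_stops:
  assumes "feasible_plan w S \<pi>" "snd ` items (arrived S) \<subseteq> A"
  shows "stops_within A (plan_stops \<pi>)"
proof -
  have "set (concat (current \<pi> # later \<pi>)) \<subseteq> items (arrived S)"
    using assms(1) by (auto simp: feasible_plan_def)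
  then show ?thesis unfolding plan_stops_def stops_within_stops using assms(2) by blast
qed

lemma items_in_aisle:
  assumes "is_situation w S"
  shows "snd ` items (arrived S) \<subseteq> in_aisle w"
proof (intro image_subsetI)
  fix b assume "b \<in> items (arrived S)"
  then obtain j s where b: "b = (j, s)" "j < length (arrived S)" "s \<in> set (snd (arrived S ! j))"
    by (auto simp: items_def)
  have "is_order w (snd (arrived S ! j))"
    using assms nth_mem[OF b(2)] by (auto simp: is_situation_def case_prod_beta)
  then show "snd b \<in> in_aisle w" using b by (auto simp: is_order_def)
qed

lemma plan_stops_in_grid:
  "is_situation w S \<Longrightarrow> feasible_plan w S \<pi> \<Longrightarrow> stops_within (grid w) (plan_stops \<pi>)"
  using stops_within_plan_stops items_in_aisle in_aisle_subset_grid by blast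

lemma plan_completion_eq:
  assumes "is_situation w S" "feasible_plan w S \<pi>"
  shows "plan_completion sys w S \<pi> = now S + tour sys w (position S) (plan_stops \<pi>)"
  unfolding plan_completion_def
  using plan_stops_in_grid[OF assms] assms(1)
  by (intro completion_eq_tour) (auto simp: is_situation_def)

text \<open>Whatever has been picked so far, an offline solution can still be completed: first
  the commenced orders are completed in an arbitrary sequence, then the untouched orders are
  served in the batches of the solution.\<close>

lemma completing_plan:
  assumes sit: "is_situation w S" and sol: "solution w (arrived S) Bs"
    and B: "distinct B" "set B = {b \<in> items (arrived S) - picked S. fst b \<in> fst ` picked S}"
  obtains \<pi> where "feasible_plan w S \<pi>"
    and "tour sys w (position S) (plan_stops \<pi>) \<le> tour sys w (position S) (picks B)
           + wdist w (end_loc sys w (position S) (picks B)) (depot w) + tour sys w (depot w) (stops Bs)"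
proof
  let ?P = "picked S" and ?p = "position S"
  define untouched :: "item \<Rightarrow> bool" where "untouched = (\<lambda>b. fst b \<notin> fst ` ?P)"
  define L where "L = filter (\<lambda>B. B \<noteq> []) (map (filter untouched) Bs)"
  define \<pi> where "\<pi> = \<lparr>current = B, later = L, motion = (\<lambda>_. depot w)\<rparr>"
  have concat_L: "concat L = filter untouched (concat Bs)"
    by (simp add: L_def concat_nonempty filter_concat)
  have sit': "cart S \<subseteq> fst ` ?P" "card (cart S) \<le> capacity w" "?p \<in> grid w" "?P \<subseteq> items (arrived S)"
    using sit by (simp_all add: is_situation_def)
  have commenced: "batch_orders B \<subseteq> cart S"
    using sit B(2) by (fastforce simp: is_situation_def batch_orders_def)
  have "finite (cart S)"
    using sit'(1,4) finite_items finite_subset by (metis finite_imageI)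
  moreover have "cart_loads w (map batch_orders L)"
    unfolding L_def
  proof (rule cart_loads_nonempty)
    have "cart_loads w (map batch_orders Bs)" using sol by (simp add: solution_def)
    then have "cart_loads w (map (\<lambda>X. batch_orders (filter untouched X)) Bs)"
      by (rule cart_loads_mono) (unfold batch_orders_def, intro image_mono, simp add: subset_iff)
    then show "cart_loads w (map batch_orders (map (filter untouched) Bs))" by (simp add: o_def)
  qed
  moreover have "cart S \<inter> batch_orders X = {}" if "X \<in> set L" for X
    using that sit'(1) by (fastforce simp: L_def batch_orders_def untouched_def)
  ultimately have "cart_loads w ((cart S \<union> batch_orders B) # map batch_orders L)"
    using commenced sit'(2) by (simp add: cart_loads_Cons Un_absorb2)
  moreover have "[] \<notin> set L" by (simp add: L_def)
  moreover have "set (concat (B # L)) = items (arrived S) - ?P"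
    using sol B(2) unfolding concat.simps set_append concat_L
    by (auto simp: solution_def untouched_def)
  moreover have "distinct (concat (B # L))"
    using sol B unfolding concat.simps distinct_append concat_L
    by (auto simp: solution_def untouched_def)
  ultimately show feas: "feasible_plan w S \<pi>"
    by (simp add: feasible_plan_def \<pi>_def)
  have Bs: "stops_within (grid w) (stops Bs)"
    using sol items_in_aisle[OF sit] in_aisle_subset_grid by (auto simp: solution_def)
  have "stops_within (grid w) (picks B)"
    using B(2) items_in_aisle[OF sit] in_aisle_subset_grid by auto
  then have e: "end_loc sys w ?p (picks B) \<in> grid w" using sit'(3) by (intro end_loc_in_grid)
  have "subseq (Finish # stops L) (Finish # stops Bs)"
    using stops_restrict_subseq by (simp add: L_def)
  from tour_subseq[OF this depot_in_grid e, of sys]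
  have "tour sys w (end_loc sys w ?p (picks B)) (Finish # stops L)
      \<le> wdist w (end_loc sys w ?p (picks B)) (depot w) + tour sys w (depot w) (stops Bs)"
    using Bs depot_in_grid by simp
  then show "tour sys w ?p (plan_stops \<pi>) \<le> tour sys w ?p (picks B)
      + wdist w (end_loc sys w ?p (picks B)) (depot w) + tour sys w (depot w) (stops Bs)"
    by (simp add: plan_stops_def \<pi>_def)
qed

text \<open>The items of commenced orders are collected on one walk through the grid, followed by a return to
  the depot. At the depot with an empty cart there is nothing to complete first.\<close>

lemma optimal_plan_le:
  assumes sit: "is_situation w S" and sol: "solution w (arrived S) Bs" and opt: "optimal_plan sys w S \<pi>"
  shows "plan_completion sys w S \<pi> \<le> now S + (traversal_bound + diameter_bound) + tour sys w (depot w) (stops Bs)"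
    and "position S = depot w \<Longrightarrow> cart S = {} \<Longrightarrow>
           plan_completion sys w S \<pi> \<le> now S + tour sys w (depot w) (stops Bs)"
proof -
  let ?X = "{b \<in> items (arrived S) - picked S. fst b \<in> fst ` picked S}"
  have X: "snd ` ?X \<subseteq> in_aisle w" using items_in_aisle[OF sit] by blast
  have p: "position S \<in> grid w" using sit by (simp add: is_situation_def)
  obtain B where B: "distinct B" "set B = ?X" "tour sys w (position S) (picks B) \<le> traversal_bound"
    using traverse_items[OF _ X, of sys] finite_items p by auto
  obtain \<pi>' where \<pi>': "feasible_plan w S \<pi>'"
    "tour sys w (position S) (plan_stops \<pi>') \<le> tour sys w (position S) (picks B)
           + wdist w (end_loc sys w (position S) (picks B)) (depot w) + tour sys w (depot w) (stops Bs)"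
    using completing_plan[OF sit sol B(1,2)] by blast
  have "end_loc sys w (position S) (picks B) \<in> grid w"
    using p X B(2) in_aisle_subset_grid by (intro end_loc_in_grid) auto
  then have "wdist w (end_loc sys w (position S) (picks B)) (depot w) \<le> diameter_bound"
    by (intro wdist_le_diameter depot_in_grid)
  moreover have le: "plan_completion sys w S \<pi> \<le> now S + tour sys w (position S) (plan_stops \<pi>')"
    using opt \<pi>'(1) plan_completion_eq[OF sit \<pi>'(1)] by (metis optimal_plan_def)
  ultimately show "plan_completion sys w S \<pi> \<le> now S + (traversal_bound + diameter_bound) + tour sys w (depot w) (stops Bs)"
    using \<pi>'(2) B(3) by linarith
  assume at_depot: "position S = depot w" and empty: "cart S = {}"
  have commenced: "\<forall>(j, s) \<in> items (arrived S) - picked S. j \<in> fst ` picked S \<longrightarrow> j \<in> cart S"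
    using sit by (simp add: is_situation_def)
  have "?X = {}"
  proof (rule equals0I)
    fix b assume "b \<in> ?X"
    then show False using commenced empty by (cases b) auto
  qed
  then have "set B = {}" by (simp only: B(2))
  then have "B = []" by simp
  then show "plan_completion sys w S \<pi> \<le> now S + tour sys w (depot w) (stops Bs)"
    using at_depot le \<pi>'(2) depot_in_grid by simp
qed

lemma optimal_planD:
  assumes "optimal_plan sys w S \<pi>"
  shows "feasible_plan w S \<pi>" "1-lipschitz_on {now S..} (motion \<pi>)" "motion \<pi> ` {now S..} \<subseteq> grid w"
    "visits sys w (motion \<pi>) (now S) (position S) (plan_stops \<pi>)"
  using assms by (simp_all add: optimal_plan_def)

end

section \<open>The offline optimum\<close>

context valid_warehouse
begin

lemma solution_in_grid:
  "valid_inst w I \<Longrightarrow> schedule w I Bs \<Longrightarrow> stops_within (grid w) (stops Bs)"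
  using valid_inst_items in_aisle_subset_grid by (force simp: schedule_def)

text \<open>Empty batches are dropped, which does not delay the picker.\<close>

lemma ciopt_le:
  assumes I: "valid_inst w I" and sch: "schedule w I Bs"
  shows "ciopt sys w I \<le> completion sys w (\<lambda>j. fst (I ! j)) 0 (depot w) (stops Bs)"
proof -
  let ?r = "\<lambda>j. fst (I ! j)" and ?Bs = "filter (\<lambda>B. B \<noteq> []) Bs"
  have grid: "stops_within (grid w) (stops Bs)" using solution_in_grid[OF I sch] .
  have grid': "stops_within (grid w) (stops ?Bs)"
    using grid by (simp add: concat_nonempty del: set_concat)
  have "ciopt sys w I \<le> completion sys w ?r 0 (depot w) (stops ?Bs)"
    unfolding ciopt_def
  proof (rule cINF_lower)
    show "bdd_below ((\<lambda>Bs. completion sys w ?r 0 (depot w) (stops Bs)) ` {Bs. solution w I Bs})"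
      using solution_in_grid[OF I] depot_in_grid
      by (intro bdd_belowI2[of _ 0] completion_ge_start) (auto simp: solution_iff_schedule)
  qed (use solution_nonempty_batches[OF sch] in simp)
  also have "\<dots> \<le> completion sys w ?r 0 (depot w) (stops Bs)"
    using completion_subseq[OF stops_nonempty_subseq[of Bs], of 0 "depot w" "depot w" 0 sys ?r]
      wdist_nonneg[of "end_loc sys w (depot w) (stops ?Bs)" "end_loc sys w (depot w) (stops Bs)"]
      end_loc_in_grid grid grid' depot_in_grid by (simp del: stops_within_stops)
  finally show ?thesis .
qed

lemma ciopt_ge:
  assumes "valid_inst w I"
    and "\<And>Bs. solution w I Bs \<Longrightarrow> b \<le> completion sys w (\<lambda>j. fst (I ! j)) 0 (depot w) (stops Bs)"
  shows "b \<le> ciopt sys w I"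
proof -
  have "\<forall>(r, xs) \<in> set I. is_order w xs" using assms(1) by (auto simp: valid_inst_def)
  then have "{Bs. solution w I Bs} \<noteq> {}" using solution_exists[OF valid] by blast
  then show ?thesis unfolding ciopt_def using assms(2) by (intro cINF_greatest) simp_all
qed

text \<open>The last order has an item, which is not picked before its arrival.\<close>

lemma ciopt_ge_last_arrival:
  assumes I: "valid_inst w I" "I \<noteq> []"
  shows "fst (last I) \<le> ciopt sys w I"
proof (rule ciopt_ge[OF I(1)])
  fix Bs assume sol: "solution w I Bs"
  let ?j = "length I - 1"
  have "snd (I ! ?j) \<noteq> []" using valid_instD(2)[OF I(1), of ?j] I(2) by (simp add: is_order_def)
  then obtain s where "s \<in> set (snd (I ! ?j))" by (meson list.set_sel(1))
  then have "(?j, s) \<in> items I" using I(2) by (simp add: items_def)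
  then have "Pick ?j s \<in> set (stops Bs)" using sol by (simp add: Pick_in_stops solution_def del: set_concat)
  then show "fst (last I) \<le> completion sys w (\<lambda>j. fst (I ! j)) 0 (depot w) (stops Bs)"
    using completion_ge_release[of ?j s "stops Bs" "depot w" "\<lambda>j. fst (I ! j)"]
      solution_in_grid[OF I(1), of Bs] sol depot_in_grid I(2)
    by (simp add: last_conv_nth solution_iff_schedule del: stops_within_stops)
qed

text \<open>A batch takes at most \<open>capacity w\<close> wide orders, and travels at least \<open>\<delta>\<close> if it takes any.\<close>

lemma tour_ge_wide_orders:
  assumes "0 < \<delta>" "p \<in> grid w" "stops_within (grid w) (stops Bs)"
    and "\<forall>B \<in> set Bs. finite (batch_orders B) \<and> card (batch_orders B) \<le> capacity w"
    and "\<forall>B \<in> set Bs. \<forall>j \<in> batch_orders B \<inter> J. wide sys \<delta> (ords j) \<and> (\<forall>s \<in> set (ords j). (j, s) \<in> set B)"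
  shows "\<delta> * real (card (J \<inter> (\<Union>B \<in> set Bs. batch_orders B))) \<le> real (capacity w) * tour sys w p (stops Bs)"
  using assms(2-)
proof (induction Bs arbitrary: p)
  case (Cons B Bs)
  let ?U = "\<Union>B \<in> set Bs. batch_orders B"
  let ?q = "end_loc sys w p (stops [B])"
  have B: "stops_within (grid w) (stops [B])" "stops_within (grid w) (stops Bs)"
    using Cons.prems(2) by auto
  have "\<delta> * real (card (J \<inter> batch_orders B)) \<le> real (capacity w) * tour sys w p (stops [B])"
  proof (cases "J \<inter> batch_orders B = {}")
    case True
    then show ?thesis using tour_nonneg[OF Cons.prems(1) B(1), of sys] by simp
  next
    case False
    then obtain j where "j \<in> batch_orders B \<inter> J" by blast
    then have "\<delta> \<le> tour sys w p (stops [B])"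
      using Cons.prems(1,4) B(1) assms(1) by (intro tour_ge_wide[of sys \<delta> "ords j" j]) auto
    moreover have "card (J \<inter> batch_orders B) \<le> capacity w"
      using Cons.prems(3) card_mono[of "batch_orders B" "J \<inter> batch_orders B"] by auto
    ultimately show ?thesis
      using assms(1) by (subst mult.commute, intro mult_mono) auto
  qed
  moreover have "\<delta> * real (card (J \<inter> ?U)) \<le> real (capacity w) * tour sys w ?q (stops Bs)"
    using Cons.prems B end_loc_in_grid[OF Cons.prems(1) B(1)] by (intro Cons.IH) auto
  moreover have "card (J \<inter> (\<Union>B \<in> set (B # Bs). batch_orders B)) \<le> card (J \<inter> batch_orders B) + card (J \<inter> ?U)"
    by (simp add: Int_Un_distrib card_Un_le)
  then have "\<delta> * real (card (J \<inter> (\<Union>B \<in> set (B # Bs). batch_orders B)))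
      \<le> \<delta> * real (card (J \<inter> batch_orders B)) + \<delta> * real (card (J \<inter> ?U))"
    using assms(1) by (simp flip: distrib_left of_nat_add)
  moreover have "tour sys w p (stops (B # Bs)) = tour sys w p (stops [B]) + tour sys w ?q (stops Bs)"
    by simp
  ultimately show ?case by (simp add: distrib_left)
qed simp

lemma ciopt_ge_wide_orders:
  assumes I: "valid_inst w I" and \<delta>: "0 < \<delta>"
  shows "\<delta> * real (card {j. j < length I \<and> wide sys \<delta> (snd (I ! j))}) \<le> real (capacity w) * ciopt sys w I"
proof -
  let ?J = "{j. j < length I \<and> wide sys \<delta> (snd (I ! j))}"
  have c: "real (capacity w) > 0" using valid by (simp add: is_warehouse_def)
  have "\<delta> * real (card ?J) / real (capacity w) \<le> ciopt sys w I"
  proof (rule ciopt_ge[OF I])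
    fix Bs assume sol: "solution w I Bs"
    then have sch: "schedule w I Bs" by (simp add: solution_iff_schedule)
    have "j \<in> (\<Union>B \<in> set Bs. batch_orders B)" if j: "j < length I" for j
    proof -
      obtain s where "s \<in> set (snd (I ! j))"
        using valid_instD(2)[OF I j] unfolding is_order_def by (meson list.set_sel(1))
      then have "(j, s) \<in> set (concat Bs)" using sch j by (simp add: schedule_def items_def del: set_concat)
      then show ?thesis by (force simp: batch_orders_def)
    qed
    then have "?J \<inter> (\<Union>B \<in> set Bs. batch_orders B) = ?J" by blast
    moreover have "\<delta> * real (card (?J \<inter> (\<Union>B \<in> set Bs. batch_orders B)))
        \<le> real (capacity w) * tour sys w (depot w) (stops Bs)"
    proof (rule tour_ge_wide_orders[OF \<delta> depot_in_grid solution_in_grid[OF I sch]])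
      show "\<forall>B \<in> set Bs. finite (batch_orders B) \<and> card (batch_orders B) \<le> capacity w"
        using sch by (simp add: schedule_def cart_loads_def)
      show "\<forall>B \<in> set Bs. \<forall>j \<in> batch_orders B \<inter> ?J. wide sys \<delta> (snd (I ! j)) \<and>
          (\<forall>s \<in> set (snd (I ! j)). (j, s) \<in> set B)"
      proof (intro ballI conjI)
        fix B j s assume "B \<in> set Bs" "j \<in> batch_orders B \<inter> ?J" "s \<in> set (snd (I ! j))"
        then show "(j, s) \<in> set B"
          by (intro schedule_batch_complete[OF sch]) (simp_all add: items_def)
      qed simp
    qed
    ultimately have "\<delta> * real (card ?J) / real (capacity w) \<le> tour sys w (depot w) (stops Bs)"
      using c by (simp add: divide_le_eq mult.commute)
    then show "\<delta> * real (card ?J) / real (capacity w)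
        \<le> completion sys w (\<lambda>j. fst (I ! j)) 0 (depot w) (stops Bs)"
      using completion_ge_tour[of 0 sys "depot w" "stops Bs" "\<lambda>j. fst (I ! j)"] by simp
  qed
  then show ?thesis using c by (simp add: divide_le_eq mult.commute)
qed

end

section \<open>The course of the policies\<close>

subsection \<open>The interventionist policy\<close>

fun serve :: "stop \<Rightarrow> nat set \<times> item set \<Rightarrow> nat set \<times> item set" where
  "serve (Pick j s) CP = (insert j (fst CP), insert (j, s) (snd CP))"
| "serve Finish CP = ({}, snd CP)"

lemma fold_serve_picks: "fold serve (picks C) (A, P) = (A \<union> batch_orders C, P \<union> set C)"
  by (induction C arbitrary: A P) auto

lemma fold_serve_stops:
  "fold serve (stops Ds) (A, P) = (if Ds = [] then A else {}, P \<union> set (concat Ds))"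
  by (induction Ds arbitrary: A P) (auto simp: fold_serve_picks)

text \<open>The empty batch at the end stands for the cart that is loaded after the last return.\<close>

lemma stops_split:
  assumes "stops Bs = ys @ zs"
  shows "\<exists>Bs1 B1 B2 Bs2. Bs @ [[]] = Bs1 @ (B1 @ B2) # Bs2 \<and> ys = stops Bs1 @ picks B1"
  using assms
proof (induction Bs arbitrary: ys)
  case Nil
  then show ?case by (intro exI[of _ "[]"]) auto
next
  case (Cons B Bs)
  consider us where "picks B = ys @ us" | us where "ys = picks B @ us" "Finish # stops Bs = us @ zs"
    using Cons.prems by (auto simp: append_eq_append_conv2)
  then show ?case
  proof cases
    case 1
    then have "ys = picks (take (length ys) B)" by (simp flip: take_map)
    then show ?thesis
      by (intro exI[of _ "[]"] exI[of _ "take (length ys) B"] exI[of _ "drop (length ys) B"]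
          exI[of _ "Bs @ [[]]"]) simp
  next
    case 2
    show ?thesis
    proof (cases us)
      case Nil
      then show ?thesis
        using 2(1) by (intro exI[of _ "[]"] exI[of _ B] exI[of _ "[]"] exI[of _ "Bs @ [[]]"]) simp
    next
      case (Cons u us')
      then have "stops Bs = us' @ zs" using 2(2) by simp
      from Cons.IH[OF this] obtain Bs1 B1 B2 Bs2
        where "Bs @ [[]] = Bs1 @ (B1 @ B2) # Bs2" "us' = stops Bs1 @ picks B1" by blast
      then show ?thesis
        using 2 Cons
        by (intro exI[of _ "B # Bs1"] exI[of _ B1] exI[of _ B2] exI[of _ Bs2]) simp
    qed
  qed
qed

context valid_warehouse
begin

text \<open>The part of a plan that is executed by time \<open>u\<close> is a prefix of its stops. Because the picker moves at
  unit speed, her distance from the last of these stops is at most the time elapsed since then.\<close>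

lemma execute_prefix:
  assumes "visits sys w m t p xs" "p \<in> grid w" "stops_within (grid w) xs"
    and "1-lipschitz_on {t0..} m" "m ` {t0..} \<subseteq> grid w" "t0 \<le> t" "t \<le> u"
  obtains ys zs where "xs = ys @ zs" "execute sys w u t p xs CP = fold serve ys CP"
    and "t + tour sys w p ys + wdist w (end_loc sys w p ys) (m u) \<le> u"
proof -
  have "\<exists>ys zs. xs = ys @ zs \<and> execute sys w u t p xs CP = fold serve ys CP \<and>
          t + tour sys w p ys + wdist w (end_loc sys w p ys) (m u) \<le> u"
    using assms(1-3,6,7)
  proof (induction xs arbitrary: t p CP)
    case Nil
    then show ?case by simp
  next
    case (Cons x xs)
    define q where "q = stop_loc sys w p x"
    have q: "q \<in> grid w" unfolding q_def using Cons.prems by (intro stop_loc_in_grid)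
    show ?case
    proof (cases "t + wdist w p q \<le> u")
      case True
      have "visits sys w m (t + wdist w p q) q xs" using Cons.prems(1) by (simp add: q_def Let_def)
      moreover have "t0 \<le> t + wdist w p q" using Cons.prems(2,4) q wdist_nonneg[of p q] by simp
      moreover have "stops_within (grid w) xs" using Cons.prems(3) stops_within_ConsD by blast
      ultimately obtain ys zs where "xs = ys @ zs"
        "execute sys w u (t + wdist w p q) q xs (serve x CP) = fold serve ys (serve x CP)"
        "t + wdist w p q + tour sys w q ys + wdist w (end_loc sys w q ys) (m u) \<le> u"
        using Cons.IH[of "t + wdist w p q" q "serve x CP"] q True by blast
      moreover have "execute sys w u t p (x # xs) CP = execute sys w u (t + wdist w p q) q xs (serve x CP)"
        using True by (cases x) (simp_all add: q_def Let_def)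
      ultimately show ?thesis
        by (intro exI[of _ "x # ys"] exI[of _ zs]) (simp add: q_def)
    next
      case False
      have "m t = p" using Cons.prems(1) by simp
      then have "wdist w p (m u) \<le> u - t"
        using wdist_along_motion[OF assms(4,5) Cons.prems(4,5)] by simp
      then show ?thesis
        using False by (intro exI[of _ "[]"] exI[of _ "x # xs"]) (simp add: q_def Let_def)
    qed
  qed
  then show ?thesis using that by blast
qed

lemma visits_depot:
  assumes "visits sys w m t (depot w) xs" "stops_within {depot w} xs" "t \<le> u"
  shows "m u = depot w"
  using assms
proof (induction xs)
  case (Cons x xs)
  have "stop_loc sys w (depot w) x = depot w" using Cons.prems(2) by (cases x) auto
  then show ?case
    using Cons stops_within_ConsD[OF Cons.prems(2)] depot_in_grid by (simp add: Let_def)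
qed simp

text \<open>The actual course up to time \<open>t\<close> is compared with a schedule that visits the same
  stops in the same sequence as early as the arrivals permit: after its last stop, the place \<open>p\<close> of the
  picker can be reached by time \<open>t\<close>.\<close>

definition history :: "system \<Rightarrow> inst \<Rightarrow> real \<Rightarrow> loc \<Rightarrow> batch list \<Rightarrow> batch \<Rightarrow> bool" where
  "history sys I t p Ds C \<longleftrightarrow> 0 \<le> t \<and> p \<in> grid w
     \<and> (\<exists>k X Y. k \<le> length (arrived_by I t) \<and> schedule w (take k I) (Ds @ (C @ X) # Y))
     \<and> completion sys w (\<lambda>j. fst (I ! j)) 0 (depot w) (stops Ds @ picks C)
         + wdist w (end_loc sys w (depot w) (stops Ds @ picks C)) p \<le> t"

lemma history_initial:
  assumes "0 \<le> t"
  shows "history sys I t (depot w) [] []"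
proof -
  have "schedule w (take 0 I) ([] @ ([] @ []) # [])"
    by (simp add: schedule_def items_def cart_loads_def)
  then have "\<exists>k X Y. k \<le> length (arrived_by I t) \<and> schedule w (take k I) ([] @ ([] @ X) # Y)"
    by blast
  then show ?thesis using assms depot_in_grid by (simp add: history_def)
qed

lemma history_wait:
  assumes "history sys I t p Ds C" "t \<le> u"
  shows "history sys I u p Ds C"
proof -
  obtain k X Y where k: "k \<le> length (arrived_by I t)" "schedule w (take k I) (Ds @ (C @ X) # Y)"
    using assms(1) unfolding history_def by blast
  have "k \<le> length (arrived_by I u)" using k(1) arrived_by_mono[OF assms(2), of I] by simp
  with k(2) have "\<exists>k X Y. k \<le> length (arrived_by I u) \<and> schedule w (take k I) (Ds @ (C @ X) # Y)"
    by blast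
  then show ?thesis using assms by (simp add: history_def)
qed

lemma history_is_situation:
  "valid_inst w I \<Longrightarrow> history sys I t p Ds C \<Longrightarrow> is_situation w (history_situation I t p Ds C)"
  unfolding history_def using is_situation_history by blast

lemma history_plan:
  assumes "valid_inst w I" "history sys I t p Ds C" "feasible_plan w (history_situation I t p Ds C) \<pi>"
  shows "schedule w (arrived_by I t) (Ds @ (C @ current \<pi>) # later \<pi>)"
  using assms schedule_history_plan unfolding history_def by blast

lemma arrived_by_in_grid:
  assumes "valid_inst w I" "schedule w (take k I) Bs"
  shows "stops_within (grid w) (stops Bs)"
proof -
  have "valid_inst w (take k I)"
    using assms(1) by (auto simp: valid_inst_def take_map[symmetric] sorted_wrt_take dest: in_set_takeD)
  then show ?thesis using solution_in_grid assms(2) by blast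
qed

text \<open>Continuing the course with stops at arrived orders keeps the schedule ahead of the picker.\<close>

lemma history_continue:
  assumes I: "valid_inst w I" and h: "history sys I t p Ds C"
    and ys: "stops_within (grid w) ys" "\<And>j s. Pick j s \<in> set ys \<Longrightarrow> j < length (arrived_by I t)"
  shows "completion sys w (\<lambda>j. fst (I ! j)) 0 (depot w) ((stops Ds @ picks C) @ ys)
           + wdist w (end_loc sys w (depot w) ((stops Ds @ picks C) @ ys)) (end_loc sys w p ys)
           \<le> t + tour sys w p ys"
proof -
  let ?r = "\<lambda>j. fst (I ! j)" and ?hs = "stops Ds @ picks C"
  obtain k X Y where "schedule w (take k I) (Ds @ (C @ X) # Y)" using h by (auto simp: history_def)
  from arrived_by_in_grid[OF I this] have "stops_within (grid w) ?hs" by auto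
  then have q: "end_loc sys w (depot w) ?hs \<in> grid w" by (intro end_loc_in_grid depot_in_grid)
  have p: "p \<in> grid w" using h by (simp add: history_def)
  have "completion sys w ?r (completion sys w ?r 0 (depot w) ?hs) (end_loc sys w (depot w) ?hs) ys
      + wdist w (end_loc sys w (end_loc sys w (depot w) ?hs) ys) (end_loc sys w p ys)
      \<le> completion sys w ?r t p ys"
    using h p q ys(1) by (intro completion_subseq) (auto simp: history_def)
  also have "\<dots> = t + tour sys w p ys"
    using ys nth_arrived_by p by (intro completion_eq_tour) auto
  finally show ?thesis by simp
qed

lemma plan_stops_arrived:
  assumes "feasible_plan w (history_situation I t p Ds C) \<pi>" "Pick j s \<in> set (plan_stops \<pi>)"
  shows "j < length (arrived_by I t)"
proof -
  have "(j, s) \<in> set (concat (current \<pi> # later \<pi>))"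
    using assms(2) unfolding plan_stops_def Pick_in_stops .
  then have "(j, s) \<in> items (arrived_by I t)"
    using assms(1) by (auto simp: feasible_plan_def history_situation_def)
  then show ?thesis by (simp add: items_def)
qed

text \<open>The plan together with the history is a schedule, and the stops executed by time \<open>u\<close> cut this
  schedule at a later point.\<close>

lemma history_execute:
  assumes I: "valid_inst w I" and h: "history sys I t p Ds C" and "t \<le> u"
    and opt: "optimal_plan sys w (history_situation I t p Ds C) \<pi>"
  obtains Ds' C' where "history sys I u (motion \<pi> u) Ds' C'"
    and "execute sys w u t p (plan_stops \<pi>) (batch_orders C, set (concat Ds) \<union> set C)
           = (batch_orders C', set (concat Ds') \<union> set C')"
proof -
  let ?CP = "(batch_orders C, set (concat Ds) \<union> set C)"
  let ?S = "history_situation I t p Ds C"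
  let ?r = "\<lambda>j. fst (I ! j)"
  have S: "now ?S = t" "position ?S = p" by (simp_all add: history_situation_def)
  note \<pi> = optimal_planD[OF opt, unfolded S]
  have p: "p \<in> grid w" "0 \<le> t" using h by (simp_all add: history_def)
  have within: "stops_within (grid w) (plan_stops \<pi>)"
    using plan_stops_in_grid history_is_situation[OF I h] \<pi>(1) by blast
  obtain ys zs where ys: "plan_stops \<pi> = ys @ zs"
    and exec: "execute sys w u t p (plan_stops \<pi>) ?CP = fold serve ys ?CP"
    and time: "t + tour sys w p ys + wdist w (end_loc sys w p ys) (motion \<pi> u) \<le> u"
    by (rule execute_prefix[OF \<pi>(4) p(1) within \<pi>(2,3) order_refl \<open>t \<le> u\<close>])
  have "stops (current \<pi> # later \<pi>) = ys @ zs" using ys by (simp only: plan_stops_def)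
  from stops_split[OF this] obtain Bs1 B1 B2 Bs2
    where split: "(current \<pi> # later \<pi>) @ [[]] = Bs1 @ (B1 @ B2) # Bs2"
    and ys_eq: "ys = stops Bs1 @ picks B1" by (elim exE conjE)
  have sch: "schedule w (arrived_by I t) ((Ds @ (C @ current \<pi>) # later \<pi>) @ [[]])"
    using schedule_insert_Nil[of w _ "Ds @ (C @ current \<pi>) # later \<pi>" "[]"] history_plan[OF I h \<pi>(1)]
    by simp
  have "\<exists>Ds' C' X Y. (Ds @ (C @ current \<pi>) # later \<pi>) @ [[]] = Ds' @ (C' @ X) # Y \<and>
      stops Ds' @ picks C' = (stops Ds @ picks C) @ ys \<and>
      fold serve ys ?CP = (batch_orders C', set (concat Ds') \<union> set C')"
  proof (cases Bs1)
    \<comment> \<open>The current batch has not been finished by time \<open>u\<close>.\<close>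
    case Nil
    then show ?thesis
      using split ys_eq
      by (intro exI[of _ Ds] exI[of _ "C @ B1"] exI[of _ B2] exI[of _ Bs2])
        (auto simp: fold_serve_picks)
  next
    case (Cons B Bs1')
    then show ?thesis
      using split ys_eq
      by (intro exI[of _ "Ds @ (C @ B) # Bs1'"] exI[of _ B1] exI[of _ B2] exI[of _ Bs2])
        (auto simp: fold_serve_picks fold_serve_stops)
  qed
  then obtain Ds' C' X Y where new: "(Ds @ (C @ current \<pi>) # later \<pi>) @ [[]] = Ds' @ (C' @ X) # Y"
    "stops Ds' @ picks C' = (stops Ds @ picks C) @ ys"
    "fold serve ys ?CP = (batch_orders C', set (concat Ds') \<union> set C')" by blast
  have u: "motion \<pi> u \<in> grid w" using \<pi>(3) \<open>t \<le> u\<close> by auto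
  have ys_within: "stops_within (grid w) ys" using within ys by simp
  have "schedule w (take (length (arrived_by I t)) I) (Ds' @ (C' @ X) # Y)"
    using sch unfolding new(1) by (simp flip: arrived_by_eq_take)
  moreover have "length (arrived_by I t) \<le> length (arrived_by I u)"
    using arrived_by_mono[OF \<open>t \<le> u\<close>] .
  moreover have "completion sys w ?r 0 (depot w) (stops Ds' @ picks C')
      + wdist w (end_loc sys w (depot w) (stops Ds' @ picks C')) (motion \<pi> u) \<le> u"
  proof -
    let ?e = "end_loc sys w (depot w) (stops Ds' @ picks C')"
    have "stops_within (grid w) (stops (Ds' @ (C' @ X) # Y))"
      using arrived_by_in_grid[OF I calculation(1)] .
    then have "stops_within (grid w) (stops Ds' @ picks C')" by auto
    then have e: "?e \<in> grid w" by (intro end_loc_in_grid depot_in_grid)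
    have e': "end_loc sys w p ys \<in> grid w" using end_loc_in_grid[OF p(1) ys_within] .
    have "completion sys w ?r 0 (depot w) (stops Ds' @ picks C') + wdist w ?e (end_loc sys w p ys)
        \<le> t + tour sys w p ys"
      unfolding new(2) using plan_stops_arrived[OF \<pi>(1)] ys
      by (intro history_continue[OF I h ys_within]) auto
    then show ?thesis using time wdist_triangle[OF e e' u] by linarith
  qed
  ultimately have "history sys I u (motion \<pi> u) Ds' C'"
    using u p(2) \<open>t \<le> u\<close> unfolding history_def by (auto simp del: stops_simps)
  then show ?thesis using that[of Ds' C'] unfolding exec new(3) by blast
qed

text \<open>When the last plan is made, history and plan form a schedule of the whole instance, which the
  picker follows at best in the earliest possible time.\<close>

lemma ciopt_le_plan_completion:
  assumes I: "valid_inst w I" and h: "history sys I t p Ds C" and all: "arrived_by I t = I"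
    and opt: "optimal_plan sys w (history_situation I t p Ds C) \<pi>"
  shows "ciopt sys w I \<le> plan_completion sys w (history_situation I t p Ds C) \<pi>"
proof -
  let ?S = "history_situation I t p Ds C"
  let ?r = "\<lambda>j. fst (I ! j)" and ?xs = "(stops Ds @ picks C) @ plan_stops \<pi>"
  note feas = optimal_planD(1)[OF opt]
  note sit = history_is_situation[OF I h]
  have within: "stops_within (grid w) (plan_stops \<pi>)" using plan_stops_in_grid[OF sit feas] .
  have sch: "schedule w I (Ds @ (C @ current \<pi>) # later \<pi>)" using history_plan[OF I h feas] all by simp
  have eq: "stops (Ds @ (C @ current \<pi>) # later \<pi>) = ?xs" by (simp add: plan_stops_def)
  have grid: "end_loc sys w (depot w) ?xs \<in> grid w" "end_loc sys w p (plan_stops \<pi>) \<in> grid w"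
    using end_loc_in_grid[OF depot_in_grid solution_in_grid[OF I sch], of sys] unfolding eq
    using end_loc_in_grid[OF _ within] h by (auto simp: history_def)
  have "ciopt sys w I \<le> completion sys w ?r 0 (depot w) ?xs"
    using ciopt_le[OF I sch] unfolding eq .
  also have "\<dots> \<le> t + tour sys w p (plan_stops \<pi>)"
  proof -
    have "completion sys w ?r 0 (depot w) ?xs
        + wdist w (end_loc sys w (depot w) ?xs) (end_loc sys w p (plan_stops \<pi>))
        \<le> t + tour sys w p (plan_stops \<pi>)"
      by (intro history_continue[OF I h within]) (rule plan_stops_arrived[OF feas])
    then show ?thesis using wdist_nonneg[OF grid] by linarith
  qed
  also have "\<dots> = plan_completion sys w ?S \<pi>"
    using plan_completion_eq[OF sit feas] by (simp add: history_situation_def)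
  finally show ?thesis .
qed

text \<open>The objective of the interventionist policy is the value of the plan that is made at the last
  arrival. If all items lie at the depot, the picker stays there once she is there.\<close>

lemma interventionist_last:
  assumes I: "valid_inst w I" and \<rho>: "reopt_rule sys w \<rho>" and "sorted (t # ts)"
    and "history sys I t p Ds C"
  shows "\<exists>p' Ds' C'. history sys I (last (t # ts)) p' Ds' C'
           \<and> (snd ` items I \<subseteq> {depot w} \<longrightarrow> p = depot w \<longrightarrow> p' = depot w)
           \<and> interventionist sys w \<rho> I p (batch_orders C, set (concat Ds) \<union> set C) (t # ts)
               = plan_completion sys w (history_situation I (last (t # ts)) p' Ds' C')
                   (\<rho> (history_situation I (last (t # ts)) p' Ds' C'))"
  using assms(3,4)
proof (induction ts arbitrary: t p Ds C)
  case Nil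
  then show ?case
    by (intro exI[of _ p] exI[of _ Ds] exI[of _ C]) (simp add: history_situation_def)
next
  case (Cons u ts)
  let ?S = "history_situation I t p Ds C"
  note h = Cons.prems(2)
  have sit: "is_situation w ?S" using history_is_situation[OF I h] .
  then have opt: "optimal_plan sys w ?S (\<rho> ?S)" using \<rho> by (simp add: reopt_rule_def)
  have "t \<le> u" using Cons.prems(1) by simp
  obtain Ds' C' where h': "history sys I u (motion (\<rho> ?S) u) Ds' C'"
    and exec: "execute sys w u t p (plan_stops (\<rho> ?S)) (batch_orders C, set (concat Ds) \<union> set C)
           = (batch_orders C', set (concat Ds') \<union> set C')"
    using history_execute[OF I h \<open>t \<le> u\<close> opt] by blast
  have step: "interventionist sys w \<rho> I p (batch_orders C, set (concat Ds) \<union> set C) (t # u # ts)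
      = interventionist sys w \<rho> I (motion (\<rho> ?S) u) (batch_orders C', set (concat Ds') \<union> set C') (u # ts)"
    by (simp only: interventionist.simps(2)[of sys w \<rho> I p _ t "u # ts"] Let_def list.case
        fst_conv snd_conv history_situation_def exec[unfolded history_situation_def])
  have stay: "motion (\<rho> ?S) u = depot w" if "snd ` items I \<subseteq> {depot w}" "p = depot w"
  proof (rule visits_depot[OF _ _ \<open>t \<le> u\<close>])
    show "visits sys w (motion (\<rho> ?S)) t (depot w) (plan_stops (\<rho> ?S))"
      using optimal_planD(4)[OF opt] that(2) by (simp add: history_situation_def)
    have "items (arrived ?S) \<subseteq> items I"
      unfolding history_situation_def situation.select_convs
      by (subst arrived_by_eq_take) (auto simp: items_take)
    then show "stops_within {depot w} (plan_stops (\<rho> ?S))"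
      using that(1) by (intro stops_within_plan_stops[OF optimal_planD(1)[OF opt]]) blast
  qed
  have "sorted (u # ts)" using Cons.prems(1) by simp
  from Cons.IH[OF this h'] obtain p' Ds'' C'' where
    "history sys I (last (u # ts)) p' Ds'' C''"
    "snd ` items I \<subseteq> {depot w} \<longrightarrow> motion (\<rho> ?S) u = depot w \<longrightarrow> p' = depot w"
    "interventionist sys w \<rho> I (motion (\<rho> ?S) u) (batch_orders C', set (concat Ds') \<union> set C') (u # ts)
      = plan_completion sys w (history_situation I (last (u # ts)) p' Ds'' C'')
          (\<rho> (history_situation I (last (u # ts)) p' Ds'' C''))" by blast
  moreover have "last (t # u # ts) = last (u # ts)" by simp
  ultimately show ?case unfolding step using stay by metis
qed

end

context valid_warehouse
begin

lemma arrived_by_last: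
  assumes "valid_inst w I" "I \<noteq> []" "fst (last I) \<le> t"
  shows "arrived_by I t = I"
proof (rule arrived_by_all[OF assms(1)])
  fix r xs assume "(r, xs) \<in> set I"
  then obtain j where "j < length I" "I ! j = (r, xs)" by (meson in_set_conv_nth)
  moreover have "fst (I ! j) \<le> fst (I ! (length I - 1))"
    using calculation assms(2) by (intro valid_instD(3)[OF assms(1)]) auto
  ultimately show "r \<le> t" using assms(2,3) by (simp add: last_conv_nth)
qed

lemma last_arrival_eq_Max:
  assumes "valid_inst w I" "I \<noteq> []"
  shows "last (sorted_list_of_set (fst ` set I)) = fst (last I)" "fst ` set I \<noteq> {}"
proof -
  let ?xs = "sorted_list_of_set (fst ` set I)"
  show ne: "fst ` set I \<noteq> {}" using assms(2) by simp
  have set: "set ?xs = fst ` set I" by simp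
  then have ne': "?xs \<noteq> []" using ne by (metis set_empty)
  have "last ?xs \<in> fst ` set I" using ne' set last_in_set by blast
  then obtain b where "b \<in> set I" "fst b = last ?xs" by auto
  then obtain j where j: "j < length I" "fst (I ! j) = last ?xs" by (metis in_set_conv_nth)
  have "fst (I ! j) \<le> fst (I ! (length I - 1))"
    using j(1) assms(2) by (intro valid_instD(3)[OF assms(1)]) auto
  then have "last ?xs \<le> fst (last I)" using j(2) assms(2) by (simp add: last_conv_nth)
  moreover have "fst (last I) \<le> last ?xs"
  proof -
    have "fst (last I) \<in> set ?xs" using set assms(2) by simp
    then obtain i where i: "i < length ?xs" "?xs ! i = fst (last I)" by (metis in_set_conv_nth)
    then have "?xs ! i \<le> ?xs ! (length ?xs - 1)" by (intro sorted_nth_mono) auto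
    then show ?thesis using i(2) ne' by (simp add: last_conv_nth)
  qed
  ultimately show "last ?xs = fst (last I)" by simp
qed

text \<open>The last plan is made at the last arrival and is not longer than completing the commenced
  orders and then following any offline solution.\<close>

lemma interventionist_bounds:
  assumes I: "valid_inst w I" "I \<noteq> []" and \<rho>: "reopt_rule sys w \<rho>" and sys: "sys \<noteq> PcartN"
  shows "ciopt sys w I \<le> reopt sys w \<rho> I"
    and "solution w I Bs \<Longrightarrow>
           reopt sys w \<rho> I \<le> fst (last I) + (traversal_bound + diameter_bound) + tour sys w (depot w) (stops Bs)"
    and "snd ` items I \<subseteq> {depot w} \<Longrightarrow> reopt sys w \<rho> I \<le> fst (last I)"
proof -
  let ?R = "fst (last I)"
  obtain t ts where ts: "sorted_list_of_set (fst ` set I) = t # ts"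
    using last_arrival_eq_Max(2)[OF I] by (metis List.finite_set finite_imageI list.exhaust sorted_list_of_set_eq_Nil_iff)
  have last: "last (t # ts) = ?R" using last_arrival_eq_Max(1)[OF I] ts by simp
  have "sorted (t # ts)" unfolding ts[symmetric] by simp
  moreover have "t \<in> fst ` set I"
    using ts by (metis List.finite_set finite_imageI list.set_intros(1) set_sorted_list_of_set)
  then have "0 \<le> t" using I(1) by (auto simp: valid_inst_def)
  then have "history sys I t (depot w) [] []" by (rule history_initial)
  ultimately obtain p Ds C where h: "history sys I ?R p Ds C"
    and stay: "snd ` items I \<subseteq> {depot w} \<Longrightarrow> p = depot w"
    and eq: "interventionist sys w \<rho> I (depot w) (batch_orders [], set (concat []) \<union> set []) (t # ts)
      = plan_completion sys w (history_situation I ?R p Ds C) (\<rho> (history_situation I ?R p Ds C))"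
    using interventionist_last[OF I(1) \<rho>, of t ts "depot w" "[]" "[]"] unfolding last by blast
  let ?S = "history_situation I ?R p Ds C"
  have reopt: "reopt sys w \<rho> I = plan_completion sys w ?S (\<rho> ?S)"
    using eq sys ts by (simp add: reopt_def)
  have all: "arrived_by I ?R = I" using arrived_by_last[OF I order_refl] .
  have sit: "is_situation w ?S" using history_is_situation[OF I(1) h] .
  then have opt: "optimal_plan sys w ?S (\<rho> ?S)" using \<rho> by (simp add: reopt_rule_def)
  have S: "now ?S = ?R" "arrived ?S = I" "position ?S = p" using all by (simp_all add: history_situation_def)
  show "ciopt sys w I \<le> reopt sys w \<rho> I"
    unfolding reopt by (rule ciopt_le_plan_completion[OF I(1) h all opt])
  show "reopt sys w \<rho> I \<le> ?R + (traversal_bound + diameter_bound) + tour sys w (depot w) (stops Bs)"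
    if "solution w I Bs"
    using optimal_plan_le(1)[OF sit _ opt, of Bs] that unfolding reopt S .
  assume degenerate: "snd ` items I \<subseteq> {depot w}"
  have "stops_within {depot w} (plan_stops (\<rho> ?S))"
    using degenerate by (intro stops_within_plan_stops[OF optimal_planD(1)[OF opt]]) (simp add: S)
  then have "tour sys w (depot w) (plan_stops (\<rho> ?S)) = 0" by (rule tour_eq_0_at_depot)
  then show "reopt sys w \<rho> I \<le> ?R"
    using plan_completion_eq[OF sit optimal_planD(1)[OF opt], of sys] stay[OF degenerate]
    unfolding reopt S by simp
qed

subsection \<open>The non-interventionist policy\<close>

text \<open>A batch of an optimal plan for pushcarts is not longer than a walk through the grid, since the
  batch could be replaced by this walk.\<close>

lemma optimal_batch_le:
  assumes sit: "is_situation w S" "position S = depot w" "cart S = {}"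
    and opt: "optimal_plan sys w S \<pi>" and sys: "sys \<noteq> Robot"
    and B: "B \<in> set (current \<pi> # later \<pi>)"
  shows "tour sys w (depot w) (stops [B]) \<le> traversal_bound + diameter_bound"
proof -
  note feas = optimal_planD(1)[OF opt]
  obtain Us Vs where L: "current \<pi> # later \<pi> = Us @ B # Vs" using B by (meson split_list)
  have L_feas: "distinct (concat (Us @ B # Vs))" "set (concat (Us @ B # Vs)) = items (arrived S) - picked S"
    "cart_loads w (map batch_orders (Us @ B # Vs))"
    using feas sit(3) by (simp_all add: feasible_plan_def flip: L)
  have "snd ` set B \<subseteq> in_aisle w"
    using L_feas(2) items_in_aisle[OF sit(1)] by auto
  then obtain B' where B': "distinct B'" "set B' = set B" "tour sys w (depot w) (picks B') \<le> traversal_bound"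
    using traverse_items[of "set B" sys] depot_in_grid by auto
  define L' where "L' = Us @ B' # Vs"
  define \<pi>' where "\<pi>' = \<lparr>current = hd L', later = tl L', motion = motion \<pi>\<rparr>"
  have L': "current \<pi>' # later \<pi>' = L'" by (simp add: \<pi>'_def L'_def hd_Cons_tl)
  have orders: "batch_orders B' = batch_orders B" by (simp add: batch_orders_def B'(2))
  have concat: "concat L' = concat Us @ B' @ concat Vs" by (simp add: L'_def)
  have "distinct (concat L')" "set (concat L') = items (arrived S) - picked S"
    using L_feas(1,2) B'(1,2) unfolding concat by auto
  moreover have "cart_loads w (map batch_orders L')" using L_feas(3) by (simp add: L'_def orders)
  moreover have "[] \<notin> set (tl L')"
  proof (cases Us)
    case Nil
    then show ?thesis using L feas by (simp add: L'_def feasible_plan_def)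
  next
    case (Cons U Us')
    then have "later \<pi> = Us' @ B # Vs" using L by simp
    then have "[] \<notin> set (Us' @ B # Vs)" using feas by (simp add: feasible_plan_def)
    then have "B' \<noteq> []" "[] \<notin> set (Us' @ Vs)" using B'(2) by auto
    then show ?thesis by (simp add: L'_def Cons)
  qed
  then have "[] \<notin> set (later \<pi>')" by (simp add: \<pi>'_def)
  ultimately have feas': "feasible_plan w S \<pi>'"
    using sit(3) unfolding L'[symmetric] by (simp add: feasible_plan_def)
  have "tour sys w (depot w) (plan_stops \<pi>) \<le> tour sys w (depot w) (plan_stops \<pi>')"
  proof -
    have "plan_completion sys w S \<pi> \<le> plan_completion sys w S \<pi>'"
      using opt feas' unfolding optimal_plan_def by blast
    then show ?thesis
      using plan_completion_eq[OF sit(1) feas, of sys] plan_completion_eq[OF sit(1) feas', of sys] sit(2)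
      by simp
  qed
  then have "tour sys w (depot w) (stops [B]) \<le> tour sys w (depot w) (stops [B'])"
    unfolding plan_stops_def L L' unfolding L'_def tour_stops_pushcart[OF sys, of "_ @ _"] by simp
  also have "\<dots> = tour sys w (depot w) (picks B') + wdist w (end_loc sys w (depot w) (picks B')) (depot w)"
    using sys by simp
  also have "\<dots> \<le> traversal_bound + diameter_bound"
  proof -
    have "end_loc sys w (depot w) (picks B') \<in> grid w"
      using \<open>snd ` set B \<subseteq> in_aisle w\<close> B'(2) in_aisle_subset_grid depot_in_grid by (intro end_loc_in_grid) auto
    then show ?thesis using B'(3) wdist_le_diameter[OF _ depot_in_grid] by (intro add_mono)
  qed
  finally show ?thesis .
qed

text \<open>Invariant of the non-interventionist policy, if no batch is longer than \<open>G\<close>: a batch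
  that is under way at the last arrival returns within \<open>G\<close>, and from then on the picker follows a
  plan that is not longer than any offline solution.\<close>

definition depot_state :: "inst \<Rightarrow> real \<Rightarrow> real \<Rightarrow> nat \<Rightarrow> batch list \<Rightarrow> batch list \<Rightarrow> bool" where
  "depot_state I G t k Ds Bs \<longleftrightarrow> history PcartN I t (depot w) Ds [] \<and> k \<le> length (arrived_by I t)
     \<and> schedule w (take k I) (Ds @ Bs)
     \<and> (\<forall>B \<in> set Bs. tour PcartN w (depot w) (stops [B]) \<le> G)
     \<and> (k < length I \<longrightarrow> t \<le> fst (last I) + G)
     \<and> (k = length I \<longrightarrow> (\<forall>Cs. solution w I Cs \<longrightarrow>
          t + tour PcartN w (depot w) (stops Bs) \<le> fst (last I) + G + tour PcartN w (depot w) (stops Cs)))"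

text \<open>A new plan is made only if further orders have arrived, so the outer induction is on the number of
  orders that have not been planned yet; between two plans, the batches of the current plan are
  worked off.\<close>

lemma non_interventionist_bounds_aux:
  fixes G
  assumes I: "valid_inst w I" "I \<noteq> []" and \<rho>: "reopt_rule PcartN w \<rho>" and "0 \<le> G"
    and G: "\<And>S \<pi> B. is_situation w S \<Longrightarrow> items (arrived S) \<subseteq> items I \<Longrightarrow> position S = depot w \<Longrightarrow> cart S = {} \<Longrightarrow>
        optimal_plan PcartN w S \<pi> \<Longrightarrow> B \<in> set (current \<pi> # later \<pi>) \<Longrightarrow>
        tour PcartN w (depot w) (stops [B]) \<le> G"
    and "depot_state I G t k Ds Bs"
  shows "ciopt PcartN w I \<le> non_interventionist w \<rho> I t k Bs (set (concat Ds))
    \<and> (\<forall>Cs. solution w I Cs \<longrightarrow> non_interventionist w \<rho> I t k Bs (set (concat Ds))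
          \<le> fst (last I) + G + tour PcartN w (depot w) (stops Cs))"
    (is "?ok t k Ds Bs")
  using \<open>depot_state I G t k Ds Bs\<close>
proof (induction "length I - k" arbitrary: t k Ds Bs rule: less_induct)
  case less
  have replan: "?ok t k Ds Bs" if st: "depot_state I G t k Ds Bs" and new: "k < length (arrived_by I t)" for t Ds Bs
  proof -
    let ?S = "history_situation I t (depot w) Ds []" and ?k = "length (arrived_by I t)"
    define \<pi> where "\<pi> = \<rho> ?S"
    define As where "As = filter (\<lambda>B. B \<noteq> []) (current \<pi> # later \<pi>)"
    have h: "history PcartN I t (depot w) Ds []" using st by (simp add: depot_state_def)
    have sit: "is_situation w ?S" using history_is_situation[OF I(1) h] .
    then have opt: "optimal_plan PcartN w ?S \<pi>" using \<rho> by (simp add: reopt_rule_def \<pi>_def)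
    have S: "now ?S = t" "arrived ?S = arrived_by I t" "position ?S = depot w" "cart ?S = {}"
      by (simp_all add: history_situation_def)
    have feas: "feasible_plan w ?S \<pi>" using optimal_planD(1)[OF opt] .
    have step: "non_interventionist w \<rho> I t k Bs (set (concat Ds))
        = non_interventionist w \<rho> I t ?k As (set (concat Ds))"
      using new by (subst non_interventionist.simps)
        (simp add: Let_def \<pi>_def As_def history_situation_def del: set_concat)
    have sub: "items (arrived ?S) \<subseteq> items I"
      unfolding S by (subst arrived_by_eq_take) (auto simp: items_take)
    have le: "tour PcartN w (depot w) (stops As) \<le> tour PcartN w (depot w) (plan_stops \<pi>)"
      using tour_subseq[OF stops_nonempty_subseq[of "current \<pi> # later \<pi>"] depot_in_grid depot_in_grid, of PcartN]
        plan_stops_in_grid[OF sit feas] depot_in_grid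
      unfolding As_def plan_stops_def by simp
    have "t \<le> fst (last I) + G" using st new length_arrived_by[of I t] by (simp add: depot_state_def)
    moreover have "t + tour PcartN w (depot w) (stops As)
        \<le> fst (last I) + G + tour PcartN w (depot w) (stops Cs)"
      if k: "?k = length I" and Cs: "solution w I Cs" for Cs
    proof -
      have all: "arrived_by I t = I" using k by (subst arrived_by_eq_take) simp
      have "plan_completion PcartN w ?S \<pi> \<le> t + tour PcartN w (depot w) (stops Cs)"
        using optimal_plan_le(2)[OF sit _ opt, of Cs] Cs unfolding S all by simp
      then show ?thesis
        using le calculation plan_completion_eq[OF sit feas, of PcartN] unfolding S by simp
    qed
    moreover have "schedule w (take ?k I) (Ds @ As)"
    proof -
      have sch: "schedule w (arrived_by I t) (Ds @ ([] @ current \<pi>) # later \<pi>)"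
        using history_plan[OF I(1) h feas] .
      have "concat (Ds @ As) = concat (Ds @ ([] @ current \<pi>) # later \<pi>)"
        unfolding As_def concat_append concat_nonempty by simp
      moreover have "cart_loads w (map batch_orders (Ds @ As))"
      proof -
        have "cart_loads w (map batch_orders (Ds @ (current \<pi> # later \<pi>)))"
          using sch by (simp add: schedule_def)
        moreover have "set As \<subseteq> set (current \<pi> # later \<pi>)" by (auto simp: As_def)
        moreover have "cart_loads w (map batch_orders As)"
          unfolding As_def using calculation(1)
          by (intro cart_loads_nonempty) (simp only: map_append cart_loads_append)
        ultimately show ?thesis unfolding map_append cart_loads_append list.set_map by blast
      qed
      ultimately have "schedule w (arrived_by I t) (Ds @ As)" using sch unfolding schedule_def by simp
      then show ?thesis by (simp flip: arrived_by_eq_take)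
    qed
    moreover have "\<forall>B \<in> set As. tour PcartN w (depot w) (stops [B]) \<le> G"
      using G[OF sit sub S(3,4) opt] by (auto simp: As_def)
    ultimately have "depot_state I G t ?k Ds As" using h by (simp add: depot_state_def)
    moreover have "length I - ?k < length I - k" using new length_arrived_by[of I t] by simp
    ultimately show ?thesis unfolding step using less.hyps by blast
  qed
  show ?case
    using less.prems
  proof (induction Bs arbitrary: t Ds)
    case Nil
    note st = Nil.prems
    have h: "history PcartN I t (depot w) Ds []" using st by (simp add: depot_state_def)
    consider "k < length (arrived_by I t)" | "\<not> k < length (arrived_by I t)" "k < length I"
      | "\<not> k < length (arrived_by I t)" "k = length I"
      using st length_arrived_by[of I t] by (fastforce simp: depot_state_def)
    then show ?case
    proof cases
      case 1
      then show ?thesis using replan st by blast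
    next
      case 2
      let ?t = "fst (I ! k)"
      have k: "k = length (arrived_by I t)" using 2(1) st by (simp add: depot_state_def)
      have "t \<le> ?t" using not_arrived_by[of I t] 2(2) k by simp
      then have "history PcartN I ?t (depot w) Ds []" using history_wait[OF h] by blast
      moreover have arr: "k < length (arrived_by I ?t)"
      proof (rule ccontr)
        assume *: "\<not> k < length (arrived_by I ?t)"
        then have "length (arrived_by I ?t) < length I" using 2(2) by simp
        from not_arrived_by[OF this] show False
          using valid_instD(3)[OF I(1) 2(2), of "length (arrived_by I ?t)"] * by simp
      qed
      moreover have "?t \<le> fst (last I)"
      proof -
        have "fst (I ! k) \<le> fst (I ! (length I - 1))"
          using 2(2) by (intro valid_instD(3)[OF I(1)]) auto
        then show ?thesis using I(2) by (simp add: last_conv_nth)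
      qed
      ultimately have "depot_state I G ?t k Ds []"
        using st 2(2) \<open>0 \<le> G\<close> by (simp add: depot_state_def)
      moreover have "non_interventionist w \<rho> I t k [] (set (concat Ds))
          = non_interventionist w \<rho> I ?t k [] (set (concat Ds))"
        using 2 by (subst non_interventionist.simps) simp
      ultimately show ?thesis using replan[OF _ arr] by simp
    next
      case 3
      have stopped: "non_interventionist w \<rho> I t k [] (set (concat Ds)) = t"
        using 3 by (subst non_interventionist.simps) simp
      have sch: "schedule w I Ds" using st 3(2) by (simp add: depot_state_def)
      have "end_loc PcartN w (depot w) (stops Ds) = depot w" by simp
      then have "completion PcartN w (\<lambda>j. fst (I ! j)) 0 (depot w) (stops Ds) \<le> t"
        using h depot_in_grid by (simp add: history_def)
      then have "ciopt PcartN w I \<le> t" using ciopt_le[OF I(1) sch, of PcartN] by simp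
      then show ?thesis unfolding stopped using st 3(2) by (simp add: depot_state_def)
    qed
  next
    case (Cons B Bs)
    note st = Cons.prems
    have h: "history PcartN I t (depot w) Ds []" using st by (simp add: depot_state_def)
    show ?case
    proof (cases "k < length (arrived_by I t)")
      case True
      then show ?thesis using replan st by blast
    next
      case False
      then have k: "k = length (arrived_by I t)" using st by (simp add: depot_state_def)
      let ?c = "tour PcartN w (depot w) (stops [B])"
      let ?t = "t + ?c"
      have sch: "schedule w (take k I) (Ds @ B # Bs)" using st by (simp add: depot_state_def)
      have within: "stops_within (grid w) (stops [B])"
        using arrived_by_in_grid[OF I(1) sch] by auto
      have step: "non_interventionist w \<rho> I t k (B # Bs) (set (concat Ds))
          = non_interventionist w \<rho> I ?t k Bs (set (concat (Ds @ [B])))"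
      proof -
        have "completion PcartN w (\<lambda>_. t) t (depot w) (stops [B]) = ?t"
          using within depot_in_grid by (intro completion_eq_tour) auto
        then show ?thesis using False by (subst non_interventionist.simps) (simp add: add.assoc)
      qed
      have "0 \<le> ?c" using tour_nonneg[OF depot_in_grid within] .
      then have "t \<le> ?t" by simp
      have "j < length (arrived_by I t)" if "Pick j s \<in> set (stops [B])" for j s
      proof -
        have "(j, s) \<in> set B" using that unfolding Pick_in_stops by simp
        then have "(j, s) \<in> items (take k I)" using sch by (auto simp: schedule_def)
        then show ?thesis using k by (simp add: items_take)
      qed
      from history_continue[OF I(1) h within this]
      have "completion PcartN w (\<lambda>j. fst (I ! j)) 0 (depot w) (stops (Ds @ [B]) @ picks [])
          + wdist w (end_loc PcartN w (depot w) (stops (Ds @ [B]) @ picks [])) (depot w) \<le> ?t"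
        by simp
      moreover have "schedule w (take k I) ((Ds @ [B]) @ ([] @ []) # Bs)"
        using schedule_insert_Nil[of w _ "Ds @ [B]" Bs] sch by simp
      moreover have k': "k \<le> length (arrived_by I ?t)" using k arrived_by_mono[OF \<open>t \<le> ?t\<close>] by simp
      ultimately have "history PcartN I ?t (depot w) (Ds @ [B]) []"
        using h \<open>t \<le> ?t\<close> unfolding history_def
        by (intro conjI exI[of _ k] exI[of _ "[]"] exI[of _ Bs]) auto
      moreover have "?t \<le> fst (last I) + G" if "k < length I"
      proof -
        have "t < fst (I ! k)" using not_arrived_by[of I t] that k by simp
        also have "\<dots> \<le> fst (I ! (length I - 1))"
          using that by (intro valid_instD(3)[OF I(1)]) auto
        also have "\<dots> = fst (last I)" using I(2) by (simp add: last_conv_nth)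
        finally show ?thesis using st by (simp add: depot_state_def)
      qed
      moreover have "tour PcartN w (depot w) (stops (B # Bs)) = ?c + tour PcartN w (depot w) (stops Bs)"
        by simp
      ultimately have "depot_state I G ?t k (Ds @ [B]) Bs"
        using st k' sch unfolding depot_state_def by (simp only: append_assoc append_Cons append_Nil) auto
      from Cons.IH[OF this] show ?thesis unfolding step .
    qed
  qed
qed

text \<open>The invariant is used with the walk through the grid as the bound on a batch, and with
  \<open>G = 0\<close> if all items lie at the depot.\<close>

lemma non_interventionist_bounds:
  assumes I: "valid_inst w I" "I \<noteq> []" and \<rho>: "reopt_rule PcartN w \<rho>"
  shows "ciopt PcartN w I \<le> reopt PcartN w \<rho> I"
    and "solution w I Bs \<Longrightarrow>
           reopt PcartN w \<rho> I \<le> fst (last I) + (traversal_bound + diameter_bound) + tour PcartN w (depot w) (stops Bs)"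
    and "snd ` items I \<subseteq> {depot w} \<Longrightarrow> reopt PcartN w \<rho> I \<le> fst (last I)"
proof -
  have last: "0 \<le> fst (last I)" using valid_instD(1)[OF I(1), of "length I - 1"] I(2) by (simp add: last_conv_nth)
  have initial: "depot_state I G 0 0 [] []" if "0 \<le> G" for G
    using history_initial[of 0 PcartN I] I(2) that last
    by (simp add: depot_state_def schedule_def items_def)
  have reopt: "reopt PcartN w \<rho> I = non_interventionist w \<rho> I 0 0 [] (set (concat []))"
    by (simp add: reopt_def)
  have G: "0 \<le> traversal_bound + diameter_bound"
    using traversal_bound_nonneg diameter_bound_nonneg by simp
  note bounds = non_interventionist_bounds_aux[OF I \<rho> _ _ initial, folded reopt]
  have *: "ciopt PcartN w I \<le> reopt PcartN w \<rho> I \<and> (\<forall>Cs. solution w I Cs \<longrightarrow> reopt PcartN w \<rho> I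
      \<le> fst (last I) + (traversal_bound + diameter_bound) + tour PcartN w (depot w) (stops Cs))"
    by (rule bounds[OF G _ G]) (rule optimal_batch_le, auto)
  then show "ciopt PcartN w I \<le> reopt PcartN w \<rho> I"
    "solution w I Bs \<Longrightarrow>
       reopt PcartN w \<rho> I \<le> fst (last I) + (traversal_bound + diameter_bound) + tour PcartN w (depot w) (stops Bs)"
    by blast+
  assume degenerate: "snd ` items I \<subseteq> {depot w}"
  have "tour PcartN w (depot w) (stops [B]) \<le> 0"
    if "items (arrived S) \<subseteq> items I" "optimal_plan PcartN w S \<pi>" "B \<in> set (current \<pi> # later \<pi>)" for S \<pi> B
  proof -
    have "stops_within {depot w} (plan_stops \<pi>)"
      using that(1) degenerate by (intro stops_within_plan_stops[OF optimal_planD(1)[OF that(2)]]) blast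
    then have "stops_within {depot w} (stops [B])"
      using that(3) unfolding plan_stops_def stops_within_stops by auto
    then have "tour PcartN w (depot w) (stops [B]) = 0" by (rule tour_eq_0_at_depot)
    then show ?thesis by (rule eq_refl)
  qed
  then have **: "\<forall>Cs. solution w I Cs \<longrightarrow> reopt PcartN w \<rho> I
      \<le> fst (last I) + 0 + tour PcartN w (depot w) (stops Cs)"
    using bounds[of 0, OF order_refl _ order_refl] by blast
  obtain Cs where Cs: "solution w I Cs"
    using solution_exists[OF valid, of I] I(1) by (force simp: valid_inst_def)
  then have "stops_within {depot w} (stops Cs)"
    using degenerate unfolding stops_within_stops by (simp add: solution_def del: set_concat)
  then show "reopt PcartN w \<rho> I \<le> fst (last I)"
    using ** Cs tour_eq_0_at_depot(1)[of "stops Cs" PcartN] by force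
qed

subsection \<open>Comparison with the offline optimum\<close>

text \<open>The travel time of a solution is at most its completion time, so the bounds in terms of arbitrary
  solutions become a bound in terms of the offline optimum. If all items lie at the depot, both
  objectives are exactly the last arrival time; a bound up to a constant would be of no use there,
  because the last arrival time may stay bounded or even be 0.\<close>

lemma reopt_bounds:
  assumes I: "valid_inst w I" "I \<noteq> []" and \<rho>: "reopt_rule sys w \<rho>"
  shows "ciopt sys w I \<le> reopt sys w \<rho> I"
    and "reopt sys w \<rho> I \<le> fst (last I) + (traversal_bound + diameter_bound) + ciopt sys w I"
    and "snd ` items I \<subseteq> {depot w} \<Longrightarrow> reopt sys w \<rho> I = fst (last I) \<and> ciopt sys w I = fst (last I)"
proof -
  let ?K = "traversal_bound + diameter_bound"
  show le: "ciopt sys w I \<le> reopt sys w \<rho> I"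
    using interventionist_bounds(1)[OF I \<rho>] non_interventionist_bounds(1)[OF I] \<rho> by (cases "sys = PcartN") auto
  have "reopt sys w \<rho> I - (fst (last I) + ?K) \<le> ciopt sys w I"
  proof (rule ciopt_ge[OF I(1)])
    fix Bs assume "solution w I Bs"
    then have "reopt sys w \<rho> I \<le> fst (last I) + ?K + tour sys w (depot w) (stops Bs)"
      using interventionist_bounds(2)[OF I \<rho>] non_interventionist_bounds(2)[OF I] \<rho> by (cases "sys = PcartN") auto
    then show "reopt sys w \<rho> I - (fst (last I) + ?K)
        \<le> completion sys w (\<lambda>j. fst (I ! j)) 0 (depot w) (stops Bs)"
      using completion_ge_tour[of 0 sys "depot w" "stops Bs" "\<lambda>j. fst (I ! j)"] by simp
  qed
  then show "reopt sys w \<rho> I \<le> fst (last I) + ?K + ciopt sys w I" by simp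
  assume "snd ` items I \<subseteq> {depot w}"
  then have "reopt sys w \<rho> I \<le> fst (last I)"
    using interventionist_bounds(3)[OF I \<rho>] non_interventionist_bounds(3)[OF I] \<rho> by (cases "sys = PcartN") auto
  then show "reopt sys w \<rho> I = fst (last I) \<and> ciopt sys w I = fst (last I)"
    using ciopt_ge_last_arrival[OF I, of sys] le by simp
qed

end

section \<open>Measurability\<close>

lemma space_order_space [simp]: "space order_space = UNIV"
  by (simp add: order_space_def)

text \<open>The \<open>\<sigma>\<close>-algebra of orders is generated by length and padded locations, so wideness is expressed by
  the existence of indices.\<close>

lemma order_space_coordinates:
  "(\<lambda>xs. (length xs, \<lambda>i. if i < length xs then xs ! i else 0))
     \<in> order_space \<rightarrow>\<^sub>M count_space UNIV \<Otimes>\<^sub>M (\<Pi>\<^sub>M i \<in> (UNIV :: nat set). (borel :: loc measure))"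
  unfolding order_space_def
  by (rule measurable_vimage_algebra1) (auto simp: space_pair_measure space_PiM)

lemma measurable_length [measurable]: "length \<in> order_space \<rightarrow>\<^sub>M count_space UNIV"
  using measurable_compose[OF order_space_coordinates measurable_fst] by simp

lemma measurable_item [measurable]:
  "(\<lambda>xs. if i < length xs then xs ! i else 0) \<in> order_space \<rightarrow>\<^sub>M (borel :: loc measure)"
  using measurable_compose[OF order_space_coordinates
      measurable_compose[OF measurable_snd measurable_component_singleton[of i]]] by simp

context valid_warehouse
begin

lemma sets_wide: "{xs. wide sys \<delta> xs} \<in> sets order_space"
proof -
  define item where "item = (\<lambda>i (xs :: order_list). if i < length xs then xs ! i else (0 :: loc))"
  have [measurable]: "item i \<in> order_space \<rightarrow>\<^sub>M borel" for i
    unfolding item_def by measurable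
  have bex: "(\<exists>s \<in> set xs. P s) \<longleftrightarrow> (\<exists>i. i < length xs \<and> P (xs ! i))" for P and xs :: order_list
    by (metis in_set_conv_nth)
  show ?thesis
  proof (cases "sys = Robot")
    case True
    then have "{xs. wide sys \<delta> xs} = {xs \<in> space order_space. \<exists>i. i < length xs \<and>
        (\<exists>j. j < length xs \<and> \<delta> \<le> dist (item i xs) (item j xs))}"
      by (simp add: wide_def bex item_def cong: conj_cong)
    also have "\<dots> \<in> sets order_space" by measurable
    finally show ?thesis .
  next
    case False
    then have "{xs. wide sys \<delta> xs} = {xs \<in> space order_space. \<exists>i. i < length xs \<and>
        \<delta> \<le> dist (item i xs) (depot w)}"
      by (simp add: wide_def bex item_def cong: conj_cong)
    also have "\<dots> \<in> sets order_space" by measurable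
    finally show ?thesis .
  qed
qed

end

section \<open>Two consequences of the Borel--Cantelli lemma\<close>

text \<open>Summed over \<open>n\<close>, the tail probabilities of \<open>Y\<close> at \<open>\<epsilon> * n\<close> are bounded by its mean, because at
  most \<open>z / \<epsilon> + 1\<close> multiples of \<open>\<epsilon>\<close> lie below \<open>z\<close>.\<close>

lemma sum_indicator_less:
  fixes z \<epsilon> :: real
  assumes "0 < \<epsilon>" "0 \<le> z"
  shows "(\<Sum>n<N. indicator {\<epsilon> * real n<..} z) \<le> z / \<epsilon> + 1"
proof -
  have "(\<Sum>n<N. indicator {\<epsilon> * real n<..} z) = real (card {n. n < N \<and> \<epsilon> * real n < z})"
    by (simp add: indicator_def sum.If_cases lessThan_def Int_def)
  also have "\<dots> \<le> real (nat \<lceil>z / \<epsilon>\<rceil>)"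
  proof -
    have "n < nat \<lceil>z / \<epsilon>\<rceil>" if "\<epsilon> * real n < z" for n
    proof -
      have "real n < z / \<epsilon>" using assms(1) that by (simp add: pos_less_divide_eq mult.commute)
      then have "int n < \<lceil>z / \<epsilon>\<rceil>" by (simp add: less_ceiling_iff)
      then show ?thesis by linarith
    qed
    then have "{n. n < N \<and> \<epsilon> * real n < z} \<subseteq> {..<nat \<lceil>z / \<epsilon>\<rceil>}" by auto
    then show ?thesis using card_mono[of "{..<nat \<lceil>z / \<epsilon>\<rceil>}"] by force
  qed
  also have "\<dots> \<le> z / \<epsilon> + 1"
    using assms ceiling_correct[of "z / \<epsilon>"] by (simp add: of_nat_nat)
  finally show ?thesis .
qed

context prob_space
begin

text \<open>The tail probabilities are summable since \<open>Y\<close> has a finite mean.\<close>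

lemma AE_eventually_le_linear:
  fixes Y :: "'a \<Rightarrow> real" and Ys :: "nat \<Rightarrow> 'a \<Rightarrow> real"
  assumes Y: "integrable M Y" "AE \<omega> in M. 0 \<le> Y \<omega>"
    and Ys: "\<And>j. Ys j \<in> borel_measurable M" "\<And>j. distr M borel (Ys j) = distr M borel Y"
    and \<epsilon>: "0 < \<epsilon>"
  shows "AE \<omega> in M. eventually (\<lambda>n. Ys n \<omega> \<le> \<epsilon> * real n) sequentially"
proof -
  note [measurable] = Ys(1) borel_measurable_integrable[OF Y(1)]
  define A where "A = (\<lambda>n. {\<omega> \<in> space M. \<epsilon> * real n < Ys n \<omega>})"
  have A [measurable]: "A n \<in> sets M" for n unfolding A_def by measurable
  have prob_A: "prob (A n) = (\<integral>\<omega>. indicator {\<epsilon> * real n<..} (Y \<omega>) \<partial>M)" for n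
  proof -
    have "prob (A n) = measure (distr M borel (Ys n)) {\<epsilon> * real n<..}"
      by (subst measure_distr) (auto simp: A_def intro!: arg_cong[of _ _ prob])
    also have "\<dots> = (\<integral>x. indicator {\<epsilon> * real n<..} x \<partial>distr M borel Y)"
      unfolding Ys(2) by simp
    also have "\<dots> = (\<integral>\<omega>. indicator {\<epsilon> * real n<..} (Y \<omega>) \<partial>M)"
      by (rule integral_distr) auto
    finally show ?thesis .
  qed
  have int: "integrable M (\<lambda>\<omega>. indicator {\<epsilon> * real n<..} (Y \<omega>) :: real)" for n
    by (rule integrable_const_bound[of _ 1]) auto
  have "summable (\<lambda>n. prob (A n))"
  proof (rule summableI_nonneg_bounded)
    fix N
    have "(\<Sum>n<N. prob (A n)) = (\<integral>\<omega>. (\<Sum>n<N. indicator {\<epsilon> * real n<..} (Y \<omega>)) \<partial>M)"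
      unfolding prob_A using int by (simp add: Bochner_Integration.integral_sum)
    also have "\<dots> \<le> (\<integral>\<omega>. Y \<omega> / \<epsilon> + 1 \<partial>M)"
      using Y int \<epsilon> by (intro integral_mono_AE) (auto simp: sum_indicator_less elim: eventually_mono)
    finally show "(\<Sum>n<N. prob (A n)) \<le> (\<integral>\<omega>. Y \<omega> / \<epsilon> + 1 \<partial>M)" .
  qed simp
  then have "AE \<omega> in M. eventually (\<lambda>n. \<omega> \<in> space M - A n) sequentially"
    by (intro borel_cantelli_AE1) (auto simp: emeasure_eq_measure)
  then show ?thesis
    by eventually_elim (auto simp: A_def not_less elim: eventually_mono)
qed

text \<open>A weak form of the law of large numbers: by Hoeffding's inequality, the probability of less than half
  of the expected number of occurrences decays exponentially.\<close>

lemma AE_eventually_frequency: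
  fixes X :: "nat \<Rightarrow> 'a \<Rightarrow> 'b"
  assumes indep: "indep_vars (\<lambda>_. N) X UNIV" and distr: "\<And>j. distr M N (X j) = distr M N (X 0)"
    and A: "A \<in> sets N" and p: "0 < prob {\<omega> \<in> space M. X 0 \<omega> \<in> A}"
  shows "AE \<omega> in M. eventually
    (\<lambda>n. prob {\<omega> \<in> space M. X 0 \<omega> \<in> A} / 2 * real n \<le> real (card {j. j < n \<and> X j \<omega> \<in> A})) sequentially"
proof -
  let ?p = "prob {\<omega> \<in> space M. X 0 \<omega> \<in> A}"
  define Z where "Z = (\<lambda>j \<omega>. indicator A (X j \<omega>) :: real)"
  have X [measurable]: "X j \<in> M \<rightarrow>\<^sub>M N" for j using indep by (auto simp: indep_vars_def)
  have Z [measurable]: "Z j \<in> borel_measurable M" for j unfolding Z_def using A by measurable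
  have indep_Z: "indep_vars (\<lambda>_. borel) Z UNIV"
    unfolding Z_def using A by (intro indep_vars_compose2[OF indep]) auto
  have distr_Z: "distr M borel (Z j) = distr M borel (Z 0)" for j
  proof -
    have "distr M borel (Z j) = distr (distr M N (X j)) borel (indicator A)" for j
      unfolding Z_def using A by (subst distr_distr) (auto simp: o_def)
    then show ?thesis by (simp add: distr[of j])
  qed
  have expectation: "expectation (Z 0) = ?p"
  proof -
    have "Z 0 \<omega> = indicator {\<omega> \<in> space M. X 0 \<omega> \<in> A} \<omega>" if "\<omega> \<in> space M" for \<omega>
      using that by (simp add: Z_def indicator_def)
    then have "expectation (Z 0) = expectation (indicator {\<omega> \<in> space M. X 0 \<omega> \<in> A})"
      by (intro Bochner_Integration.integral_cong) auto
    moreover have "{\<omega> \<in> space M. X 0 \<omega> \<in> A} \<inter> space M = {\<omega> \<in> space M. X 0 \<omega> \<in> A}" by auto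
    ultimately show ?thesis by (simp only: Bochner_Integration.integral_indicator)
  qed
  define B where "B = (\<lambda>n. {\<omega> \<in> space M. (\<Sum>j<n. Z j \<omega>) \<le> real n * ?p - real n * ?p / 2})"
  have B [measurable]: "B n \<in> sets M" for n unfolding B_def by measurable
  have bound: "prob (B n) \<le> exp (- (?p\<^sup>2 / 2)) ^ n" for n
  proof (cases "n = 0")
    case False
    interpret Hoeffding_ineq_iid M "{..<n}" Z "Z 0" 0 1 "expectation (Z 0)"
    proof unfold_locales
      show "indep_vars (\<lambda>_. borel) Z {..<n}" using indep_vars_subset[OF indep_Z] by simp
      show "distr M borel (Z i) = distr M borel (Z 0)" for i by (rule distr_Z)
      show "AE \<omega> in M. Z 0 \<omega> \<in> {0..1}" by (simp add: Z_def indicator_def)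
    qed simp_all
    have nonempty: "{..<n} \<noteq> {}" using False by auto
    have "prob (B n) \<le> exp (- 2 * (real n * ?p / 2)\<^sup>2 / (real n * (1 - 0)\<^sup>2))"
      using Hoeffding_ineq_le[of "real n * ?p / 2", OF _ _ nonempty] p by (simp add: B_def expectation)
    also have "- 2 * (real n * ?p / 2)\<^sup>2 / (real n * (1 - 0)\<^sup>2) = real n * (- (?p\<^sup>2 / 2))"
      using False by (simp add: power2_eq_square field_simps)
    finally show ?thesis by (simp only: exp_of_nat_mult)
  qed simp
  have "summable (\<lambda>n. exp (- (?p\<^sup>2 / 2)) ^ n)"
    using p by (intro summable_geometric) simp
  then have "summable (\<lambda>n. prob (B n))"
    by (rule summable_comparison_test_ev[rotated]) (use bound in \<open>auto intro: always_eventually\<close>)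
  then have "AE \<omega> in M. eventually (\<lambda>n. \<omega> \<in> space M - B n) sequentially"
    by (intro borel_cantelli_AE1) (auto simp: emeasure_eq_measure)
  then show ?thesis
  proof eventually_elim
    case (elim \<omega>)
    show ?case
      using elim
    proof eventually_elim
      case (elim n)
      have "(\<Sum>j<n. Z j \<omega>) = real (card {j. j < n \<and> X j \<omega> \<in> A})"
        by (simp add: Z_def indicator_def sum.If_cases lessThan_def Int_def)
      then show ?case using elim by (auto simp: B_def not_le mult.commute)
    qed
  qed
qed

end

section \<open>The ratio along a sequence of instances\<close>

context valid_warehouse
begin

text \<open>Sorting the arrival times does not permute the orders: the \<open>j\<close>-th order of the instance is \<open>ords j\<close>.\<close>

lemma order_stat_inst_props:
  assumes ords: "\<And>j. is_order w (ords j)" and ys: "\<And>j. 0 \<le> ys j"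
  defines "I \<equiv> order_stat_inst ords ys"
  shows "valid_inst w (I n)" "length (I n) = n" "j < n \<Longrightarrow> snd (I n ! j) = ords j"
    and "0 < n \<Longrightarrow> \<exists>i < n. fst (last (I n)) = ys i"
proof -
  let ?xs = "sort (map ys [0..<n])"
  have len: "length ?xs = n" by simp
  show length: "length (I n) = n" by (simp add: I_def order_stat_inst_def)
  show "j < n \<Longrightarrow> snd (I n ! j) = ords j" by (simp add: I_def order_stat_inst_def)
  have "map fst (I n) = ?xs" by (simp add: I_def order_stat_inst_def)
  moreover have "0 \<le> r \<and> is_order w xs" if "(r, xs) \<in> set (I n)" for r xs
    using set_zip_leftD[OF that[unfolded I_def order_stat_inst_def]]
      set_zip_rightD[OF that[unfolded I_def order_stat_inst_def]] ords ys by auto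
  ultimately show "valid_inst w (I n)" by (auto simp: valid_inst_def)
  assume "0 < n"
  then have "I n \<noteq> []" using length by auto
  then have "fst (last (I n)) = last ?xs"
    using \<open>map fst (I n) = ?xs\<close> by (metis last_map)
  moreover have "?xs \<noteq> []" using \<open>0 < n\<close> len by (metis length_0_conv less_irrefl)
  then have "last ?xs \<in> set ?xs" by (rule last_in_set)
  ultimately show "\<exists>i < n. fst (last (I n)) = ys i" by auto
qed

text \<open>The maximum of \<open>n\<close> values is bounded by a constant, for the finitely many early values, plus
  an arbitrarily small multiple of \<open>n\<close>.\<close>

lemma last_arrival_sublinear:
  assumes ords: "\<And>j. is_order w (ords j)" and ys: "\<And>j. 0 \<le> ys j"
    and lin: "\<And>\<epsilon>. 0 < \<epsilon> \<Longrightarrow> eventually (\<lambda>n. ys n \<le> \<epsilon> * real n) sequentially"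
  shows "(\<lambda>n. fst (last (order_stat_inst ords ys n)) / real n) \<longlonglongrightarrow> 0"
proof (rule LIMSEQ_I)
  fix e :: real assume e: "0 < e"
  let ?R = "\<lambda>n. fst (last (order_stat_inst ords ys n))"
  obtain N where N: "\<And>n. N \<le> n \<Longrightarrow> ys n \<le> e / 4 * real n"
    using lin[of "e / 4"] e by (auto simp: eventually_sequentially)
  define C where "C = (\<Sum>i<N. ys i)"
  have C: "0 \<le> C" using ys by (simp add: C_def sum_nonneg)
  obtain N' :: nat where N': "4 * C / e < real N'" using reals_Archimedean2 by blast
  have "norm (?R n / real n - 0) < e" if n: "max 1 N' \<le> n" for n
  proof -
    obtain i where i: "i < n" "?R n = ys i"
      using order_stat_inst_props(4)[of ords ys n] ords ys n by auto
    have "ys i \<le> C + e / 4 * real n"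
    proof (cases "i < N")
      case True
      then have "ys i \<le> C" unfolding C_def using ys by (intro member_le_sum) auto
      then show ?thesis using e by (simp add: add_increasing2)
    next
      case False
      then have "ys i \<le> e / 4 * real i" using N by simp
      also have "\<dots> \<le> e / 4 * real n" using i(1) e by (intro mult_left_mono) auto
      finally show ?thesis using C by simp
    qed
    moreover have "C \<le> e / 4 * real n"
    proof -
      have "4 * C / e \<le> real n" using N' n by simp
      then show ?thesis using e by (simp add: divide_le_eq mult.commute)
    qed
    ultimately have "ys i \<le> e / 2 * real n" by simp
    moreover have "e / 2 * real n < e * real n" using e n by simp
    ultimately have "ys i / real n < e" using n by (simp add: divide_less_eq)
    then show ?thesis using i(2) ys[of i] by simp
  qed
  then show "\<exists>N. \<forall>n\<ge>N. norm (?R n / real n - 0) < e" by blast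
qed

text \<open>The offline optimum grows linearly with the number of wide orders, while the loss is the last
  arrival time plus a constant.\<close>

lemma ratio_tendsto_if_wide:
  assumes \<rho>: "reopt_rule sys w \<rho>"
    and ords: "\<And>j. is_order w (ords j)" and ys: "\<And>j. 0 \<le> ys j"
    and lin: "\<And>\<epsilon>. 0 < \<epsilon> \<Longrightarrow> eventually (\<lambda>n. ys n \<le> \<epsilon> * real n) sequentially"
    and "0 < \<delta>" "0 < \<kappa>"
    and freq: "eventually (\<lambda>n. \<kappa> * real n \<le> real (card {j. j < n \<and> wide sys \<delta> (ords j)})) sequentially"
  shows "(\<lambda>n. ratio (reopt sys w \<rho> (order_stat_inst ords ys n)) (ciopt sys w (order_stat_inst ords ys n)))
           \<longlonglongrightarrow> 1"
proof -
  let ?I = "order_stat_inst ords ys"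
  let ?R = "\<lambda>n. fst (last (?I n))" and ?K = "traversal_bound + diameter_bound"
  \<comment> \<open>The reciprocal of the rate at which the wide orders make the offline optimum grow.\<close>
  define D where "D = real (capacity w) / (\<delta> * \<kappa>)"
  have c: "0 < real (capacity w)" using valid by (simp add: is_warehouse_def)
  note props = order_stat_inst_props[of ords ys, OF ords ys]
  let ?r = "\<lambda>n. ratio (reopt sys w \<rho> (?I n)) (ciopt sys w (?I n))"
  have bounds: "eventually (\<lambda>n. 1 \<le> ?r n \<and> ?r n \<le> 1 + (?R n / real n + ?K / real n) * D) sequentially"
    using freq eventually_gt_at_top[of 0]
  proof eventually_elim
    case (elim n)
    let ?a = "reopt sys w \<rho> (?I n)" and ?b = "ciopt sys w (?I n)"
    have ne: "?I n \<noteq> []" using props(2)[of n] elim(2) by auto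
    note reopt = reopt_bounds[OF props(1) ne \<rho>]
    have "{j. j < length (?I n) \<and> wide sys \<delta> (snd (?I n ! j))} = {j. j < n \<and> wide sys \<delta> (ords j)}"
      using props(2,3) by auto
    then have "\<delta> * real (card {j. j < n \<and> wide sys \<delta> (ords j)}) \<le> real (capacity w) * ?b"
      using ciopt_ge_wide_orders[OF props(1)[of n] \<open>0 < \<delta>\<close>, of sys] by simp
    moreover have "\<delta> * (\<kappa> * real n) \<le> \<delta> * real (card {j. j < n \<and> wide sys \<delta> (ords j)})"
      using elim(1) \<open>0 < \<delta>\<close> by (intro mult_left_mono) auto
    ultimately have "\<delta> * (\<kappa> * real n) \<le> real (capacity w) * ?b" by linarith
    then have b: "real n / D \<le> ?b"
      using c \<open>0 < \<delta>\<close> \<open>0 < \<kappa>\<close> by (simp add: D_def field_simps)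
    have D: "0 < D" using c \<open>0 < \<delta>\<close> \<open>0 < \<kappa>\<close> by (simp add: D_def)
    have "0 < real n / D" using D elim(2) by simp
    then have b0: "0 < ?b" using b by linarith
    have R: "0 \<le> ?R n + ?K" using reopt(1,2) by linarith
    have r: "?r n = ?a / ?b" using b0 by (simp add: ratio_def)
    have "?a / ?b \<le> (?R n + ?K + ?b) / ?b" using reopt(2) b0 by (intro divide_right_mono) auto
    also have "\<dots> = 1 + (?R n + ?K) / ?b" using b0 by (simp add: add_divide_distrib)
    also have "(?R n + ?K) / ?b \<le> (?R n + ?K) / (real n / D)"
      using R b b0 \<open>0 < real n / D\<close> by (intro divide_left_mono mult_pos_pos)
    also have "\<dots> = (?R n / real n + ?K / real n) * D"
      by (simp add: add_divide_distrib ring_distribs)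
    finally show ?case using reopt(1) b0 unfolding r by (simp add: le_divide_eq)
  qed
  have "(\<lambda>n. 1 + (?R n / real n + ?K / real n) * D) \<longlonglongrightarrow> 1 + (0 + 0) * D"
    by (intro tendsto_intros last_arrival_sublinear ords ys lin lim_const_over_n)
  then have lim: "(\<lambda>n. 1 + (?R n / real n + ?K / real n) * D) \<longlonglongrightarrow> 1" by simp
  show ?thesis
    by (rule tendsto_sandwich[OF _ _ tendsto_const lim]) (use bounds in \<open>auto elim: eventually_mono\<close>)
qed

lemma ratio_eq_1_at_depot:
  assumes \<rho>: "reopt_rule sys w \<rho>"
    and ords: "\<And>j. is_order w (ords j)" "\<And>j. set (ords j) \<subseteq> {depot w}" and ys: "\<And>j. 0 \<le> ys j"
  shows "(\<lambda>n. ratio (reopt sys w \<rho> (order_stat_inst ords ys n)) (ciopt sys w (order_stat_inst ords ys n)))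
           \<longlonglongrightarrow> 1"
proof (rule tendsto_eventually)
  let ?I = "order_stat_inst ords ys"
  note props = order_stat_inst_props[of ords ys, OF ords(1) ys]
  show "eventually (\<lambda>n. ratio (reopt sys w \<rho> (?I n)) (ciopt sys w (?I n)) = 1) sequentially"
    using eventually_gt_at_top[of 0]
  proof eventually_elim
    case (elim n)
    then have "?I n \<noteq> []" using props(2)[of n] by auto
    moreover have "snd ` items (?I n) \<subseteq> {depot w}"
      using ords(2) props(2,3) by (fastforce simp: items_def)
    ultimately have "reopt sys w \<rho> (?I n) = ciopt sys w (?I n)"
      using reopt_bounds(3)[OF props(1) _ \<rho>] by simp
    then show ?case by (simp add: ratio_def)
  qed
qed

text \<open>An order that is wide for no threshold has no two distinct points to be joined.\<close>

lemma not_wide_singleton: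
  assumes "\<And>m. \<not> wide sys (1 / real (Suc m)) xs"
  shows "s \<in> set xs \<Longrightarrow> s' \<in> (if sys = Robot then set xs else {depot w}) \<Longrightarrow> s = s'"
proof (rule ccontr)
  assume s: "s \<in> set xs" "s' \<in> (if sys = Robot then set xs else {depot w})" "s \<noteq> s'"
  then obtain m where "inverse (real (Suc m)) < dist s s'" using reals_Archimedean[of "dist s s'"] by auto
  then have "wide sys (1 / real (Suc m)) xs"
    using s unfolding wide_def by (intro bexI[of _ s] bexI[of _ s']) (auto simp: inverse_eq_divide)
  then show False using assms by blast
qed

end

theorem theorem1:
  fixes M :: "'w measure"
    and w :: warehouse
    and sys :: system
    and \<rho> :: "situation \<Rightarrow> plan"
    and Ord :: "nat \<Rightarrow> 'w \<Rightarrow> order_list"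
    and Y :: "'w \<Rightarrow> real"
    and Ys :: "nat \<Rightarrow> 'w \<Rightarrow> real"
  assumes "prob_space M"
    and "is_warehouse w"
    and "reopt_rule sys w \<rho>"
    and "prob_space.indep_vars M (\<lambda>_. order_space) Ord UNIV"
    and "\<And>j. distr M order_space (Ord j) = distr M order_space (Ord 0)"
    and "\<And>j. AE \<omega> in M. is_order w (Ord j \<omega>)"
    and "integrable M Y"
    and "AE \<omega> in M. 0 \<le> Y \<omega>"
    and "prob_space.indep_vars M (\<lambda>_. borel) Ys UNIV"
    and "\<And>j. distr M borel (Ys j) = distr M borel Y"
    and "prob_space.indep_set M
           (sets (vimage_algebra (space M) (\<lambda>\<omega> j. Ord j \<omega>) (\<Pi>\<^sub>M j \<in> UNIV. order_space)))
           (sets (vimage_algebra (space M) (\<lambda>\<omega> j. Ys j \<omega>) (\<Pi>\<^sub>M j \<in> UNIV. borel)))"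
    and "sys = Robot \<Longrightarrow> 1 < (\<integral>\<^sup>+ \<omega>. of_nat (length (Ord 0 \<omega>)) \<partial>M)"
  shows "AE \<omega> in M.
    (\<lambda>n. let I = order_stat_inst (\<lambda>j. Ord j \<omega>) (\<lambda>j. Ys j \<omega>) n
         in ratio (reopt sys w \<rho> I) (ciopt sys w I)) \<longlonglongrightarrow> 1"
proof -
  interpret prob_space M by fact
  interpret valid_warehouse w by standard fact
  have Ord [measurable]: "Ord j \<in> M \<rightarrow>\<^sub>M order_space" for j
    using assms(4) by (auto simp: indep_vars_def)
  have Ys [measurable]: "Ys j \<in> borel_measurable M" for j
    using assms(9) by (auto simp: indep_vars_def)
  have [measurable]: "Y \<in> borel_measurable M" using assms(7) by (rule borel_measurable_integrable)
  have Ys_nonneg: "AE \<omega> in M. 0 \<le> Ys j \<omega>" for j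
  proof -
    have "AE y in distr M borel Y. 0 \<le> y" using assms(8) by (subst AE_distr_iff) auto
    then have "AE y in distr M borel (Ys j). 0 \<le> y" unfolding assms(10)[of j] .
    then show ?thesis by (subst (asm) AE_distr_iff) auto
  qed
  have all_valid: "AE \<omega> in M. \<forall>j. is_order w (Ord j \<omega>) \<and> 0 \<le> Ys j \<omega>"
    unfolding AE_all_countable using assms(6) Ys_nonneg by auto
  \<comment> \<open>Either wide orders have positive probability for some threshold, and the offline optimum grows
    linearly; or almost surely no order forces any travelling. The thresholds \<open>1 / Suc m\<close> keep the
    null sets of the second case countable in number.\<close>
  show ?thesis
  proof (cases "\<exists>m. 0 < prob {\<omega> \<in> space M. wide sys (1 / real (Suc m)) (Ord 0 \<omega>)}")
    case True
    then obtain m where m: "0 < prob {\<omega> \<in> space M. wide sys (1 / real (Suc m)) (Ord 0 \<omega>)}" by blast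
    define \<delta> where "\<delta> = 1 / real (Suc m)"
    define \<kappa> where "\<kappa> = prob {\<omega> \<in> space M. wide sys \<delta> (Ord 0 \<omega>)} / 2"
    have pos: "0 < \<delta>" "0 < \<kappa>" using m by (simp_all add: \<delta>_def \<kappa>_def)
    have "AE \<omega> in M. eventually (\<lambda>n. \<kappa> * real n \<le> real (card {j. j < n \<and> wide sys \<delta> (Ord j \<omega>)})) sequentially"
      using AE_eventually_frequency[OF assms(4,5) sets_wide[of sys \<delta>]] m by (simp add: \<delta>_def \<kappa>_def)
    moreover have "AE \<omega> in M. \<forall>k. eventually (\<lambda>n. Ys n \<omega> \<le> 1 / real (Suc k) * real n) sequentially"
      unfolding AE_all_countable
      by (intro allI AE_eventually_le_linear[OF assms(7,8) Ys assms(10)]) simp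
    ultimately show ?thesis
      using all_valid
    proof eventually_elim
      case (elim \<omega>)
      have "eventually (\<lambda>n. Ys n \<omega> \<le> \<epsilon> * real n) sequentially" if "0 < \<epsilon>" for \<epsilon>
      proof -
        obtain k where k: "inverse (real (Suc k)) < \<epsilon>" using reals_Archimedean[OF \<open>0 < \<epsilon>\<close>] by blast
        have "eventually (\<lambda>n. Ys n \<omega> \<le> 1 / real (Suc k) * real n) sequentially" using elim(2) by blast
        then show ?thesis
        proof eventually_elim
          case (elim n)
          have "1 / real (Suc k) * real n \<le> \<epsilon> * real n"
            using k by (intro mult_right_mono) (simp_all add: inverse_eq_divide)
          then show ?case using elim by linarith
        qed
      qed
      then show ?case
        unfolding Let_def using elim(1,3) pos
        by (intro ratio_tendsto_if_wide[OF assms(3), where \<delta> = \<delta> and \<kappa> = \<kappa>]) auto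
    qed
  next
    case False
    have null: "AE \<omega> in M. \<not> wide sys (1 / real (Suc m)) (Ord j \<omega>)" for j m
    proof -
      let ?A = "{xs. wide sys (1 / real (Suc m)) xs}"
      have vimage: "prob {\<omega> \<in> space M. Ord i \<omega> \<in> ?A} = measure (distr M order_space (Ord i)) ?A" for i
        by (subst measure_distr) (auto simp: sets_wide intro!: arg_cong[of _ _ prob])
      have "prob {\<omega> \<in> space M. Ord j \<omega> \<in> ?A} = prob {\<omega> \<in> space M. Ord 0 \<omega> \<in> ?A}"
        unfolding vimage assms(5)[of j] ..
      also have "\<dots> = 0" using False measure_nonneg[of M "{\<omega> \<in> space M. Ord 0 \<omega> \<in> ?A}"] by (force simp: less_le)
      finally have zero: "prob {\<omega> \<in> space M. Ord j \<omega> \<in> ?A} = 0" .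
      have "{\<omega> \<in> space M. Ord j \<omega> \<in> ?A} \<in> sets M" using sets_wide[of sys "1 / real (Suc m)"] by measurable
      then have "AE \<omega> in M. \<omega> \<notin> {\<omega> \<in> space M. Ord j \<omega> \<in> ?A}"
        using zero by (intro AE_not_in) (simp add: null_sets_def emeasure_eq_measure)
      then show ?thesis by (rule AE_mp) auto
    qed
    have narrow: "AE \<omega> in M. \<forall>j m. \<not> wide sys (1 / real (Suc m)) (Ord j \<omega>)"
      unfolding AE_all_countable using null by blast
    \<comment> \<open>With robots, all orders would be singletons, contradicting the assumption on their mean size.\<close>
    have "sys \<noteq> Robot"
    proof
      assume Robot: "sys = Robot"
      have "AE \<omega> in M. length (Ord 0 \<omega>) \<le> 1"
        using narrow all_valid
      proof eventually_elim
        case (elim \<omega>)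
        have "\<forall>s \<in> set (Ord 0 \<omega>). \<forall>s' \<in> set (Ord 0 \<omega>). s = s'"
          using not_wide_singleton[of sys "Ord 0 \<omega>"] elim(1) Robot by simp
        then have "card (set (Ord 0 \<omega>)) \<le> 1" by (simp add: card_le_Suc0_iff_eq)
        moreover have "distinct (Ord 0 \<omega>)" using elim(2) by (simp add: is_order_def)
        ultimately show ?case by (simp add: distinct_card)
      qed
      then have "(\<integral>\<^sup>+ \<omega>. of_nat (length (Ord 0 \<omega>)) \<partial>M) \<le> (\<integral>\<^sup>+ \<omega>. 1 \<partial>M)"
        by (intro nn_integral_mono_AE) (auto elim!: eventually_mono simp: of_nat_le_1_iff)
      then show False using assms(12)[OF Robot] by (simp add: emeasure_space_1)
    qed
    show ?thesis
      using narrow all_valid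
    proof eventually_elim
      case (elim \<omega>)
      have "set (Ord j \<omega>) \<subseteq> {depot w}" for j
      proof
        fix s assume "s \<in> set (Ord j \<omega>)"
        then have "s = depot w"
          using not_wide_singleton[of sys "Ord j \<omega>" s "depot w"] elim(1) \<open>sys \<noteq> Robot\<close> by simp
        then show "s \<in> {depot w}" by simp
      qed
      then show ?case unfolding Let_def using elim(2) by (intro ratio_eq_1_at_depot[OF assms(3)]) auto
    qed
  qed
qed

end
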